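(* Let $\mathscr{A}$ be a $C^*$-algebra equipped with a $*$-conjugate-automorphism $\sharp$, let $\mathscr{E}$ be a right Hilbert $\mathscr{A}$-module equipped with a $\sharp$-conjugation $C$, and let $T\in\mathbb{L}_c(\mathscr{E})$ be semiregular. Then $T$ admits a polar decomposition $T=V|T|$, where $V\in\mathbb{L}_c(\mathscr{E})$ is a conjugate-partial isometry with initial submodule $\overline{\operatorname{ran}(T^* )}$; in particular, $V^*T=|T|$. Furthermore, $$T=CJ|T|,$$ where $J$ is a partial isometry in $\mathbb{L}(\mathscr{E})$ with $J^*J=P$, where $P:=V^*V$ is the initial projection of $V$. In addition, if $V$ is $C$-symmetric (that is, $V=CV^*C$), then $J^2=P$ and $JP=PJ=J$.
   Context: A $*$-conjugate-automorphism on a $C^*$-algebra $\mathscr{A}$ is a map $\sharp:\mathscr{A}\to\mathscr{A}$, $a\mapsto a^\sharp$, such that for all $a,b\in\mathscr{A}$, $\lambda\in\mathbb{C}$: (1) $(\lambda a+b)^\sharp=\bar\lambda a^\sharp+b^\sharp$; (2) $(a^\sharp)^\sharp=a$; (3) $(a^\sharp)^*=(a^* )^\sharp$; (4) $(ab)^\sharp=a^\sharp b^\sharp$. Inner products are conjugate-linear in the first variable. $\mathbb{L}(\mathscr{E})$ is the $C^*$-algebra of adjointable linear operators on $\mathscr{E}$. $\mathbb{L}_c(\mathscr{E})$ is the set of bounded conjugate-linear operators $S$ on $\mathscr{E}$ that are $\sharp$-adjointable: there is a bounded conjugate-linear $S^*$ (the $\sharp$-adjoint) with $\langle Sx,y\rangle=\langle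 x,S^*y\rangle^\sharp$ for all $x,y\in\mathscr{E}$. The product of two elements of $\mathbb{L}_c(\mathscr{E})$ lies in $\mathbb{L}(\mathscr{E})$, and $|T|=(T^*T)^{1/2}\in\mathbb{L}(\mathscr{E})$. A $\sharp$-conjugation on $\mathscr{E}$ is a bounded conjugate-linear operator $C:\mathscr{E}\to\mathscr{E}$ with $C^2=I_{\mathscr{E}}$ and $\langle Cx,Cy\rangle=\langle x,y\rangle^\sharp$ for all $x,y\in\mathscr{E}$. An operator $T$ in $\mathbb{L}(\mathscr{E})$ or $\mathbb{L}_c(\mathscr{E})$ is semiregular if $\overline{\operatorname{ran}(T)}$ and $\overline{\operatorname{ran}(T^* )}$ are orthogonally complemented in $\mathscr{E}$. A partial isometry in $\mathbb{L}(\mathscr{E})$ is an element $U$ with $UU^*U=U$. An operator $V\in\mathbb{L}_c(\mathscr{E})$ is a conjugate-partial isometry if $\langle Vx,Vy\rangle=\langle x,y\rangle^\sharp$ for all $x,y\in\ker(V)^\perp$; $\ker(V)^\perp$ is its initial submodule. *)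

theory Defs
  imports "HOL-Analysis.Analysis"
begin

class complex_banach = banach +
  fixes scaleC :: "complex \<Rightarrow> 'a \<Rightarrow> 'a"  (infixr "*\<^sub>C" 75)
  assumes scaleC_add_right: "c *\<^sub>C (x + y) = c *\<^sub>C x + c *\<^sub>C y"
    and scaleC_add_left: "(c + d) *\<^sub>C x = c *\<^sub>C x + d *\<^sub>C x"
    and scaleC_scaleC: "c *\<^sub>C (d *\<^sub>C x) = (c * d) *\<^sub>C x"
    and scaleC_of_real: "complex_of_real r *\<^sub>C x = r *\<^sub>R x"
    and norm_scaleC: "norm (c *\<^sub>C x) = cmod c * norm x"

text \<open>Not necessarily unital: \<open>real_normed_algebra\<close> is the class without a unit.\<close>

class cstar_algebra = complex_banach + real_normed_algebra +
  fixes star :: "'a \<Rightarrow> 'a"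
  assumes mult_scaleC_left: "(c *\<^sub>C a) * b = c *\<^sub>C (a * b)"
    and mult_scaleC_right: "a * (c *\<^sub>C b) = c *\<^sub>C (a * b)"
    and star_add: "star (a + b) = star a + star b"
    and star_scaleC: "star (c *\<^sub>C a) = cnj c *\<^sub>C star a"
    and star_mult: "star (a * b) = star b * star a"
    and star_star: "star (star a) = a"
    and cstar_identity: "norm (star a * a) = (norm a)\<^sup>2"

definition cstar_positive :: "'a::cstar_algebra \<Rightarrow> bool"
  where "cstar_positive a \<longleftrightarrow> (\<exists>b. a = star b * b)"

locale star_conj_automorphism =
  fixes sharp :: "'a::cstar_algebra \<Rightarrow> 'a"
  assumes sharp_conj_linear: "sharp (c *\<^sub>C a + b) = cnj c *\<^sub>C sharp a + sharp b"
    and sharp_sharp: "sharp (sharp a) = a"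
    and star_sharp: "star (sharp a) = sharp (star a)"
    and sharp_mult: "sharp (a * b) = sharp a * sharp b"

text \<open>
  Right Hilbert modules. The norm and the completeness of \<open>'e\<close> come from the type class;
  \<open>norm_eq_sqrt_ip\<close> says that this norm is the one given by the inner product. (Conjugate)
  linearity in the first variable follows from \<open>star_ip\<close>.
\<close>

locale hilbert_module =
  fixes act :: "'e::complex_banach \<Rightarrow> 'a::cstar_algebra \<Rightarrow> 'e"  (infixl "\<cdot>" 75)
    and ip :: "'e \<Rightarrow> 'e \<Rightarrow> 'a"
  assumes act_add_left: "(x + y) \<cdot> a = x \<cdot> a + y \<cdot> a"
    and act_add_right: "x \<cdot> (a + b) = x \<cdot> a + x \<cdot> b"
    and act_mult: "x \<cdot> (a * b) = x \<cdot> a \<cdot> b"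
    and act_scaleC_left: "(c *\<^sub>C x) \<cdot> a = c *\<^sub>C (x \<cdot> a)"
    and act_scaleC_right: "x \<cdot> (c *\<^sub>C a) = c *\<^sub>C (x \<cdot> a)"
    and ip_add_right: "ip x (y + z) = ip x y + ip x z"
    and ip_scaleC_right: "ip x (c *\<^sub>C y) = c *\<^sub>C ip x y"
    and ip_act_right: "ip x (y \<cdot> a) = ip x y * a"
    and star_ip: "star (ip x y) = ip y x"
    and ip_positive: "cstar_positive (ip x x)"
    and ip_definite: "ip x x = 0 \<Longrightarrow> x = 0"
    and norm_eq_sqrt_ip: "norm x = sqrt (norm (ip x x))"

definition orth :: "('e \<Rightarrow> 'e \<Rightarrow> 'a::cstar_algebra) \<Rightarrow> 'e set \<Rightarrow> 'e set"
  where "orth ip M = {y. \<forall>x\<in>M. ip x y = 0}"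

definition orth_complemented ::
    "('e::complex_banach \<Rightarrow> 'e \<Rightarrow> 'a::cstar_algebra) \<Rightarrow> 'e set \<Rightarrow> bool"
  where "orth_complemented ip M \<longleftrightarrow> (\<forall>z. \<exists>x\<in>M. \<exists>y\<in>orth ip M. z = x + y)"

definition complex_linear :: "('e::complex_banach \<Rightarrow> 'e) \<Rightarrow> bool"
  where "complex_linear S \<longleftrightarrow> (\<forall>c x y. S (c *\<^sub>C x + y) = c *\<^sub>C S x + S y)"

definition bounded_conj_linear :: "('e::complex_banach \<Rightarrow> 'e) \<Rightarrow> bool"
  where "bounded_conj_linear S \<longleftrightarrow>
    (\<forall>c x y. S (c *\<^sub>C x + y) = cnj c *\<^sub>C S x + S y) \<and> (\<exists>K. \<forall>x. norm (S x) \<le> K * norm x)"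

definition is_adjoint ::
    "('e::complex_banach \<Rightarrow> 'e \<Rightarrow> 'a::cstar_algebra) \<Rightarrow> ('e \<Rightarrow> 'e) \<Rightarrow> ('e \<Rightarrow> 'e) \<Rightarrow> bool"
  where "is_adjoint ip T S \<longleftrightarrow> (\<forall>x y. ip (T x) y = ip x (S y))"

text \<open>
  \<open>LL ip\<close> is the algebra of adjointable operators; such an operator (and its adjoint, which is
  unique) is automatically bounded and module linear.
\<close>

definition LL :: "('e::complex_banach \<Rightarrow> 'e \<Rightarrow> 'a::cstar_algebra) \<Rightarrow> ('e \<Rightarrow> 'e) set"
  where "LL ip = {T. complex_linear T \<and> (\<exists>S. is_adjoint ip T S)}"

definition adj :: "('e::complex_banach \<Rightarrow> 'e \<Rightarrow> 'a::cstar_algebra) \<Rightarrow> ('e \<Rightarrow> 'e) \<Rightarrow> 'e \<Rightarrow> 'e"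
  where "adj ip T = (THE S. is_adjoint ip T S)"

definition is_sharp_adjoint ::
    "('e::complex_banach \<Rightarrow> 'e \<Rightarrow> 'a::cstar_algebra) \<Rightarrow> ('a \<Rightarrow> 'a) \<Rightarrow> ('e \<Rightarrow> 'e) \<Rightarrow> ('e \<Rightarrow> 'e) \<Rightarrow> bool"
  where "is_sharp_adjoint ip sharp T S \<longleftrightarrow>
    bounded_conj_linear S \<and> (\<forall>x y. ip (T x) y = sharp (ip x (S y)))"

definition LLc ::
    "('e::complex_banach \<Rightarrow> 'e \<Rightarrow> 'a::cstar_algebra) \<Rightarrow> ('a \<Rightarrow> 'a) \<Rightarrow> ('e \<Rightarrow> 'e) set"
  where "LLc ip sharp = {T. bounded_conj_linear T \<and> (\<exists>S. is_sharp_adjoint ip sharp T S)}"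

definition sharp_adj ::
    "('e::complex_banach \<Rightarrow> 'e \<Rightarrow> 'a::cstar_algebra) \<Rightarrow> ('a \<Rightarrow> 'a) \<Rightarrow> ('e \<Rightarrow> 'e) \<Rightarrow> 'e \<Rightarrow> 'e"
  where "sharp_adj ip sharp T = (THE S. is_sharp_adjoint ip sharp T S)"

text \<open>Positivity in the C*-algebra \<open>LL ip\<close>, in the same form as \<open>cstar_positive\<close>.\<close>

definition LL_positive ::
    "('e::complex_banach \<Rightarrow> 'e \<Rightarrow> 'a::cstar_algebra) \<Rightarrow> ('e \<Rightarrow> 'e) \<Rightarrow> bool"
  where "LL_positive ip R \<longleftrightarrow> (\<exists>S\<in>LL ip. R = adj ip S \<circ> S)"

text \<open>\<open>|T| = (T\<^sup>*T)\<^sup>1\<^sup>/\<^sup>2\<close>: the unique positive square root of \<open>T\<^sup>*T\<close> in \<open>LL ip\<close>.\<close>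

definition sharp_abs ::
    "('e::complex_banach \<Rightarrow> 'e \<Rightarrow> 'a::cstar_algebra) \<Rightarrow> ('a \<Rightarrow> 'a) \<Rightarrow> ('e \<Rightarrow> 'e) \<Rightarrow> 'e \<Rightarrow> 'e"
  where "sharp_abs ip sharp T =
    (THE R. R \<in> LL ip \<and> LL_positive ip R \<and> R \<circ> R = sharp_adj ip sharp T \<circ> T)"

definition sharp_conjugation ::
    "('e::complex_banach \<Rightarrow> 'e \<Rightarrow> 'a::cstar_algebra) \<Rightarrow> ('a \<Rightarrow> 'a) \<Rightarrow> ('e \<Rightarrow> 'e) \<Rightarrow> bool"
  where "sharp_conjugation ip sharp C \<longleftrightarrow>
    bounded_conj_linear C \<and> C \<circ> C = id \<and> (\<forall>x y. ip (C x) (C y) = sharp (ip x y))"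

definition semiregular_c ::
    "('e::complex_banach \<Rightarrow> 'e \<Rightarrow> 'a::cstar_algebra) \<Rightarrow> ('a \<Rightarrow> 'a) \<Rightarrow> ('e \<Rightarrow> 'e) \<Rightarrow> bool"
  where "semiregular_c ip sharp T \<longleftrightarrow>
    orth_complemented ip (closure (range T)) \<and>
    orth_complemented ip (closure (range (sharp_adj ip sharp T)))"

definition initial_submodule ::
    "('e::complex_banach \<Rightarrow> 'e \<Rightarrow> 'a::cstar_algebra) \<Rightarrow> ('e \<Rightarrow> 'e) \<Rightarrow> 'e set"
  where "initial_submodule ip V = orth ip {x. V x = 0}"

definition conj_partial_isometry ::
    "('e::complex_banach \<Rightarrow> 'e \<Rightarrow> 'a::cstar_algebra) \<Rightarrow> ('a \<Rightarrow> 'a) \<Rightarrow> ('e \<Rightarrow> 'e) \<Rightarrow> bool"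
  where "conj_partial_isometry ip sharp V \<longleftrightarrow>
    V \<in> LLc ip sharp \<and>
    (\<forall>x\<in>initial_submodule ip V. \<forall>y\<in>initial_submodule ip V. ip (V x) (V y) = sharp (ip x y))"

definition partial_isometry ::
    "('e::complex_banach \<Rightarrow> 'e \<Rightarrow> 'a::cstar_algebra) \<Rightarrow> ('e \<Rightarrow> 'e) \<Rightarrow> bool"
  where "partial_isometry ip U \<longleftrightarrow> U \<in> LL ip \<and> U \<circ> adj ip U \<circ> U = U"

definition is_projection_onto ::
    "('e::complex_banach \<Rightarrow> 'e \<Rightarrow> 'a::cstar_algebra) \<Rightarrow> ('e \<Rightarrow> 'e) \<Rightarrow> 'e set \<Rightarrow> bool"
  where "is_projection_onto ip P M \<longleftrightarrow>
    P \<in> LL ip \<and> adj ip P = P \<and> P \<circ> P = P \<and> range P = M"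

end

theory Submission
  imports Defs
begin

text \<open>
  Since \<open>C\<close> is a conjugate-linear involution, \<open>S = C \<circ> T\<close> is an adjointable operator with
  \<open>S\<^sup>* \<circ> S = T\<^sup>* \<circ> T\<close>, so \<open>|T| = |S|\<close> and the problem becomes linear. The identity
  \<open>\<langle>|T| x, |T| y\<rangle> = \<langle>S x, S y\<rangle>\<close> makes \<open>|T| x \<mapsto> S x\<close> an isometry between the ranges. Its extension to
  the closures, which are complemented by semiregularity, is \<open>J\<close>, and \<open>V = C \<circ> J\<close>.
  Two facts carry the argument: the positive square root of \<open>S\<^sup>* \<circ> S\<close> exists and is unique, and
  \<open>|S|\<close> and \<open>S\<^sup>*\<close> have the same closed range. Both come from order properties of the adjointable
  operators obtained without spectral theory: square roots are limits of an iteration,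
  unitaries are isometric because they preserve the inner product, and \<open>b\<^sup>* b \<ge> 0\<close> follows from a
  growth estimate.
\<close>

section \<open>The Banach algebra of bounded operators\<close>

text \<open>
  Operators are bounded over the reals only, so that the conjugate-linear ones are included. The
  sort has \<open>monoid_mult\<close> in place of \<open>real_normed_algebra_1\<close> because \<open>'a\<close> may be trivial.
\<close>

typedef (overloaded) 'a bop = "UNIV :: ('a::real_normed_vector \<Rightarrow>\<^sub>L 'a) set" ..

setup_lifting type_definition_bop

lift_definition bapp :: "'a::real_normed_vector bop \<Rightarrow> 'a \<Rightarrow> 'a"  (infixr "\<star>" 78)
  is blinfun_apply .

instantiation bop :: (banach) "{real_normed_algebra, monoid_mult}"
begin

lift_definition zero_bop :: "'a bop" is 0 .
lift_definition one_bop :: "'a bop" is id_blinfun .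
lift_definition plus_bop :: "'a bop \<Rightarrow> 'a bop \<Rightarrow> 'a bop" is "(+)" .
lift_definition minus_bop :: "'a bop \<Rightarrow> 'a bop \<Rightarrow> 'a bop" is "(-)" .
lift_definition uminus_bop :: "'a bop \<Rightarrow> 'a bop" is uminus .
lift_definition times_bop :: "'a bop \<Rightarrow> 'a bop \<Rightarrow> 'a bop" is "(o\<^sub>L)" .
lift_definition scaleR_bop :: "real \<Rightarrow> 'a bop \<Rightarrow> 'a bop" is "(*\<^sub>R)" .
lift_definition norm_bop :: "'a bop \<Rightarrow> real" is norm .

definition "dist_bop (a :: 'a bop) b = norm (a - b)"
definition "sgn_bop (a :: 'a bop) = inverse (norm a) *\<^sub>R a"
definition "(uniformity :: ('a bop \<times> 'a bop) filter) = (INF e\<in>{0<..}. principal {(x, y). dist x y < e})"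
definition "open (U :: 'a bop set) \<longleftrightarrow> (\<forall>x\<in>U. \<forall>\<^sub>F (x', y) in uniformity. x' = x \<longrightarrow> y \<in> U)"

instance
proof
  fix a b c :: "'a bop" and r s :: real
  show "a + b + c = a + (b + c)" by transfer (simp add: add.assoc)
  show "a + b = b + a" by transfer (simp add: add.commute)
  show "0 + a = a" by transfer simp
  show "- a + a = 0" by transfer simp
  show "a - b = a + - b" by transfer simp
  show "r *\<^sub>R (a + b) = r *\<^sub>R a + r *\<^sub>R b" by transfer (simp add: scaleR_add_right)
  show "(r + s) *\<^sub>R a = r *\<^sub>R a + s *\<^sub>R a" by transfer (simp add: scaleR_add_left)
  show "r *\<^sub>R s *\<^sub>R a = (r * s) *\<^sub>R a" by transfer simp
  show "1 *\<^sub>R a = a" by transfer simp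
  show "a * b * c = a * (b * c)" by transfer (auto intro!: blinfun_eqI)
  show "(a + b) * c = a * c + b * c"
    by transfer (auto intro!: blinfun_eqI simp: blinfun.bilinear_simps)
  show "a * (b + c) = a * b + a * c"
    by transfer (auto intro!: blinfun_eqI simp: blinfun.bilinear_simps)
  show "r *\<^sub>R a * b = r *\<^sub>R (a * b)"
    by transfer (auto intro!: blinfun_eqI simp: blinfun.bilinear_simps)
  show "a * r *\<^sub>R b = r *\<^sub>R (a * b)"
    by transfer (auto intro!: blinfun_eqI simp: blinfun.bilinear_simps)
  show "1 * a = a" by transfer (auto intro!: blinfun_eqI)
  show "a * 1 = a" by transfer (auto intro!: blinfun_eqI)
  show "dist a b = norm (a - b)" by (rule dist_bop_def)
  show "sgn a = inverse (norm a) *\<^sub>R a" by (rule sgn_bop_def)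
  show "(uniformity :: ('a bop \<times> 'a bop) filter) = (INF e\<in>{0<..}. principal {(x, y). dist x y < e})"
    by (rule uniformity_bop_def)
  show "open U \<longleftrightarrow> (\<forall>x\<in>U. \<forall>\<^sub>F (x', y) in uniformity. x' = x \<longrightarrow> y \<in> U)" for U :: "'a bop set"
    by (rule open_bop_def)
  show "(norm a = 0) = (a = 0)" by transfer simp
  show "norm (a + b) \<le> norm a + norm b" by transfer (rule norm_triangle_ineq)
  show "norm (r *\<^sub>R a) = \<bar>r\<bar> * norm a" by transfer simp
  show "norm (a * b) \<le> norm a * norm b" by transfer (rule norm_blinfun_compose)
qed

end

instance bop :: (banach) banach
proof
  fix X :: "nat \<Rightarrow> 'a bop"
  have d: "dist (Rep_bop a) (Rep_bop b) = dist a b" for a b :: "'a bop"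
    by (simp add: dist_bop_def dist_norm norm_bop.rep_eq minus_bop.rep_eq)
  assume "Cauchy X"
  then have "Cauchy (\<lambda>n. Rep_bop (X n))"
    by (simp add: Cauchy_def d)
  then obtain L where "(\<lambda>n. Rep_bop (X n)) \<longlonglongrightarrow> L"
    using Cauchy_convergent convergent_def by blast
  then have "X \<longlonglongrightarrow> Abs_bop L"
    by (simp add: lim_sequentially flip: d) (simp add: Abs_bop_inverse)
  then show "convergent X" by (auto simp: convergent_def)
qed

lemma bop_eqI: "(\<And>x. a \<star> x = b \<star> x) \<Longrightarrow> a = b"
  by transfer (rule blinfun_eqI)

lemma bapp_simps [simp]:
  "(0 :: 'a::banach bop) \<star> x = 0" "(1 :: 'a bop) \<star> x = x" "(a + b :: 'a bop) \<star> x = a \<star> x + b \<star> x"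
  "(a - b :: 'a bop) \<star> x = a \<star> x - b \<star> x" "(- a :: 'a bop) \<star> x = - (a \<star> x)"
  "(a * b :: 'a bop) \<star> x = a \<star> b \<star> x" "(r *\<^sub>R a :: 'a bop) \<star> x = r *\<^sub>R (a \<star> x)"
  by (transfer; simp add: blinfun.bilinear_simps)+

lemma bapp_linear:
  "a \<star> 0 = 0" "a \<star> (x + y) = a \<star> x + a \<star> y" "a \<star> (x - y) = a \<star> x - a \<star> y"
  "a \<star> (- x) = - (a \<star> x)" "a \<star> (r *\<^sub>R x) = r *\<^sub>R (a \<star> x)"
  by (transfer; simp add: blinfun.bilinear_simps)+

lemma norm_bapp: "norm (a \<star> x) \<le> norm (a :: 'a::banach bop) * norm x"
  by transfer (rule norm_blinfun)

lemma norm_bop_le: "0 \<le> r \<Longrightarrow> (\<And>x. norm (a \<star> x) \<le> r * norm x) \<Longrightarrow> norm (a :: 'a::banach bop) \<le> r"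
  by transfer (rule norm_blinfun_bound)

lemma norm_one_bop_le: "norm (1 :: 'a::banach bop) \<le> 1"
  by transfer (rule norm_blinfun_id_le)

lemma bounded_linear_bapp_left: "bounded_linear (\<lambda>a :: 'a::banach bop. a \<star> x)"
  by (rule bounded_linear_intro[where K="norm x"]) (auto simp: norm_bapp)

lemma bounded_linear_bapp: "bounded_linear ((\<star>) a)"
  by transfer (rule blinfun.bounded_linear_right)

lemma bop_of_bounded_linear:
  assumes "bounded_linear f"
  shows "\<exists>a. \<forall>x. a \<star> x = f x"
  using assms by (intro exI[of _ "Abs_bop (Blinfun f)"])
    (simp add: bapp.rep_eq Abs_bop_inverse bounded_linear_Blinfun_apply)

lemma norm_scaleR_one_bop_le: "0 \<le> r \<Longrightarrow> norm (r *\<^sub>R 1 :: 'a::banach bop) \<le> r"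
  using mult_left_mono[OF norm_one_bop_le[where 'a='a], of r] by simp

lemma norm_square_le: "norm x \<le> r \<Longrightarrow> norm (x * x) \<le> r * r" for x :: "'b::real_normed_algebra"
  by (meson mult_mono norm_ge_zero norm_mult_ineq order.trans)

text \<open>
  The iteration \<open>Y' = (h + Y\<^sup>2) / 2\<close> with \<open>h = 1 - a\<close> is majorized by its scalar version for \<open>h = 1\<close> and
  converges to \<open>1 - r\<close>. The sets \<open>Q\<close> of interest are the self-adjoint elements and the commutants.
\<close>

lemma banach_algebra_sqrt:
  fixes a :: "'b::{real_normed_algebra, monoid_mult, banach}"
  assumes a: "norm (1 - a) \<le> 1"
  shows "\<exists>r. r * r = a \<and> norm (1 - r) \<le> 1 \<and>
    (\<forall>Q. closed Q \<longrightarrow> 1 \<in> Q \<longrightarrow> a \<in> Q \<longrightarrow> (\<forall>x\<in>Q. \<forall>y\<in>Q. x + y \<in> Q) \<longrightarrow>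
      (\<forall>t. \<forall>x\<in>Q. t *\<^sub>R x \<in> Q) \<longrightarrow> (\<forall>x\<in>Q. x * x \<in> Q) \<longrightarrow> r \<in> Q)"
proof -
  define h where "h = 1 - a"
  define Y :: "nat \<Rightarrow> 'b" where "Y = rec_nat 0 (\<lambda>_ y. (1/2) *\<^sub>R (h + y * y))"
  define y :: "nat \<Rightarrow> real" where "y = rec_nat 0 (\<lambda>_ y. (1 + y * y) / 2)"
  have Y: "Y 0 = 0" "Y (Suc n) = (1/2) *\<^sub>R (h + Y n * Y n)" for n by (simp_all add: Y_def)
  have y: "y 0 = 0" "y (Suc n) = (1 + y n * y n) / 2" for n by (simp_all add: y_def)
  have y01: "0 \<le> y n \<and> y n \<le> 1" for n
    by (induction n) (auto simp: y mult_le_one)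
  have Yy: "norm (Y n) \<le> y n" for n
  proof (induction n)
    case (Suc n)
    have "norm (h + Y n * Y n) \<le> 1 + y n * y n"
      using a Suc y01[of n]
      by (intro norm_triangle_mono) (auto simp: h_def intro!: order.trans[OF norm_mult_ineq] mult_mono)
    then show ?case by (simp add: Y y)
  qed (simp add: Y y)
  have step: "norm (Y (Suc n) - Y n) \<le> y (Suc n) - y n" for n
  proof (induction n)
    case 0 then show ?case using a by (simp add: Y y h_def)
  next
    case (Suc n)
    let ?d = "Y (Suc n) - Y n" and ?e = "y (Suc n) - y n"
    \<comment> \<open>The difference of squares without commutativity:
      \<open>u * u - v * v = u * (u - v) + (u - v) * v\<close>.\<close>
    have eq: "Y (Suc (Suc n)) - Y (Suc n) = (1/2) *\<^sub>R (Y (Suc n) * ?d + ?d * Y n)"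
      by (subst (1) Y(2), subst (2) Y(2)) (simp add: algebra_simps)
    have e: "0 \<le> ?e" using Suc norm_ge_zero order.trans by blast
    have "norm (Y (Suc n) * ?d + ?d * Y n) \<le> y (Suc n) * ?e + ?e * y n"
      by (intro norm_triangle_mono order.trans[OF norm_mult_ineq] mult_mono Yy Suc y01[THEN conjunct1] e norm_ge_zero)
    also have "\<dots> = 2 * (y (Suc (Suc n)) - y (Suc n))"
    proof -
      have "2 * y (Suc (Suc n)) = 1 + y (Suc n) * y (Suc n)" "2 * y (Suc n) = 1 + y n * y n"
        by (simp_all add: y)
      then show ?thesis by (simp only: right_diff_distrib left_diff_distrib)
    qed
    finally show ?case unfolding eq by simp
  qed
  have mono: "y m \<le> y n" if "m \<le> n" for m n
  proof (rule lift_Suc_mono_le[OF _ that])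
    show "y n \<le> y (Suc n)" for n using order.trans[OF norm_ge_zero step[of n]] by simp
  qed
  \<comment> \<open>Telescoping \<open>step\<close> lets the Cauchy property of the bounded monotone
    sequence \<open>y\<close> pass to \<open>Y\<close>.\<close>
  have dist: "norm (Y (m + k) - Y m) \<le> y (m + k) - y m" for m k
  proof (induction k)
    case (Suc k)
    have "norm (Y (m + Suc k) - Y m) \<le> norm (Y (Suc (m + k)) - Y (m + k)) + norm (Y (m + k) - Y m)"
      using norm_triangle_ineq[of "Y (Suc (m + k)) - Y (m + k)" "Y (m + k) - Y m"] by simp
    with Suc step[of "m + k"] show ?case by simp
  qed simp
  have "convergent y"
    using y01 mono by (intro Bseq_mono_convergent BseqI'[of _ 1]) (auto simp: abs_le_iff intro: order.trans[of _ 0])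
  then have cy: "Cauchy y" by (rule convergent_Cauchy)
  have "Cauchy Y"
  proof (rule metric_CauchyI)
    fix e :: real assume "0 < e"
    then obtain M where M: "\<And>m n. m \<ge> M \<Longrightarrow> n \<ge> M \<Longrightarrow> dist (y m) (y n) < e"
      using cy by (meson Cauchy_def)
    have *: "dist (Y m) (Y n) < e" if "m \<ge> M" "m \<le> n" for m n
    proof -
      obtain k where "n = m + k" using \<open>m \<le> n\<close> le_Suc_ex by blast
      with dist[of m k] M[of m n] that show ?thesis
        by (simp add: dist_norm norm_minus_commute)
    qed
    show "\<exists>M. \<forall>m\<ge>M. \<forall>n\<ge>M. dist (Y m) (Y n) < e"
      using * by (metis dist_commute nle_le)
  qed
  then obtain L where L: "Y \<longlonglongrightarrow> L" using Cauchy_convergent convergent_def by blast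
  have "(\<lambda>n. Y (Suc n)) \<longlonglongrightarrow> (1/2) *\<^sub>R (h + L * L)"
    unfolding Y(2) by (intro tendsto_intros L)
  then have LL: "L = (1/2) *\<^sub>R (h + L * L)"
    using LIMSEQ_unique LIMSEQ_Suc[OF L] by blast
  show ?thesis
  proof (intro exI[of _ "1 - L"] conjI allI impI)
    have "2 *\<^sub>R L = h + L * L" by (subst LL) simp
    then show "(1 - L) * (1 - L) = a" by (simp add: algebra_simps h_def scaleR_2)
    show "norm (1 - (1 - L)) \<le> 1"
      using LIMSEQ_le_const2[OF tendsto_norm[OF L]] order.trans[OF Yy] y01 by auto
  next
    fix Q :: "'b set"
    assume Q: "closed Q" "1 \<in> Q" "a \<in> Q" "\<forall>x\<in>Q. \<forall>y\<in>Q. x + y \<in> Q"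
      "\<forall>t. \<forall>x\<in>Q. t *\<^sub>R x \<in> Q" "\<forall>x\<in>Q. x * x \<in> Q"
    have m: "- x \<in> Q" if "x \<in> Q" for x using Q(5)[rule_format, OF that, of "-1"] by simp
    have hQ: "h \<in> Q" using Q(4)[rule_format, OF Q(2) m[OF Q(3)]] by (simp add: h_def)
    have "Y n \<in> Q" for n
    proof (induction n)
      case 0 show ?case using Q(5)[rule_format, OF Q(2), of 0] by (simp add: Y)
    next
      case (Suc n) then show ?case unfolding Y by (intro Q[rule_format] hQ)
    qed
    then have "L \<in> Q" using closed_sequentially[OF Q(1) _ L] by blast
    then show "1 - L \<in> Q" using Q(4)[rule_format, OF Q(2) m] by simp
  qed
qed

section \<open>Adjoint pairs on a Hilbert module\<close>

lemma scaleC_zero_right: "c *\<^sub>C (0 :: 'a::complex_banach) = 0"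
  using scaleC_add_right[of c 0 0] by simp

lemma scaleC_minus_right: "c *\<^sub>C (- x :: 'a::complex_banach) = - (c *\<^sub>C x)"
  using scaleC_add_right[of c x "- x"] by (simp add: scaleC_zero_right eq_neg_iff_add_eq_0 add.commute)

lemma scaleC_diff_right: "c *\<^sub>C (x - y :: 'a::complex_banach) = c *\<^sub>C x - c *\<^sub>C y"
  using scaleC_add_right[of c x "- y"] by (simp add: scaleC_minus_right)

lemma scaleC_one: "1 *\<^sub>C (x :: 'a::complex_banach) = x"
  using scaleC_of_real[of 1 x] by simp

lemma scaleC_minus_left: "(- c) *\<^sub>C (x :: 'a::complex_banach) = - (c *\<^sub>C x)"
  using scaleC_of_real[of "- 1" "c *\<^sub>C x"] by (simp add: scaleC_scaleC)

lemma bounded_linear_scaleC: "bounded_linear ((*\<^sub>C) c :: 'a::complex_banach \<Rightarrow> 'a)"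
proof (rule bounded_linear_intro[where K="cmod c"])
  fix r and x :: 'a
  show "c *\<^sub>C r *\<^sub>R x = r *\<^sub>R c *\<^sub>C x"
    by (simp add: scaleC_scaleC mult.commute flip: scaleC_of_real)
qed (simp_all add: scaleC_add_right norm_scaleC mult.commute)

lemma star_zero: "star (0 :: 'a::cstar_algebra) = 0"
  using star_add[of "0 :: 'a" 0] by simp

lemma star_scaleR: "star (r *\<^sub>R a :: 'a::cstar_algebra) = r *\<^sub>R star a"
  by (simp add: star_scaleC flip: scaleC_of_real)

context hilbert_module
begin

lemma ip_add_left: "ip (x + y) z = ip x z + ip y z"
  by (metis ip_add_right star_ip star_add)

lemma ip_scaleC_left: "ip (c *\<^sub>C x) z = cnj c *\<^sub>C ip x z"
  by (metis ip_scaleC_right star_ip star_scaleC)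

lemma ip_scaleR_right: "ip x (r *\<^sub>R y) = r *\<^sub>R ip x y"
  by (metis ip_scaleC_right scaleC_of_real)

lemma ip_scaleR_left: "ip (r *\<^sub>R x) y = r *\<^sub>R ip x y"
  by (metis ip_scaleR_right star_ip star_scaleR)

lemma norm_ip_self: "norm (ip x x) = (norm x)\<^sup>2"
  by (simp add: norm_eq_sqrt_ip)

text \<open>
  The sharp Cauchy--Schwarz inequality needs the order of the coefficient algebra. The constant
  \<open>6\<close> comes for free from polarization and the triangle inequality in \<open>'e\<close>, and suffices here.
\<close>

lemma norm_ip_le: "norm (ip x y) \<le> 6 * (norm x * norm y)"
proof -
  have sym: "norm (ip u v + ip v u) \<le> 6" if "norm u = 1" "norm v = 1" for u v
  proof -
    have "ip u v + ip v u = ip (u + v) (u + v) - ip u u - ip v v"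
      by (simp add: ip_add_left ip_add_right algebra_simps)
    also have "norm \<dots> \<le> norm (ip (u + v) (u + v)) + norm (ip u u) + norm (ip v v)"
      by (meson add_mono norm_triangle_ineq4 order.trans order_refl)
    also have "\<dots> \<le> 2\<^sup>2 + 1 + 1"
      unfolding norm_ip_self using norm_triangle_ineq[of u v] that
      by (intro add_mono power_mono) auto
    finally show ?thesis by simp
  qed
  have unit: "norm (ip u v) \<le> 6" if uv: "norm u = 1" "norm v = 1" for u v
  proof -
    let ?w = "\<i> *\<^sub>C v"
    \<comment> \<open>The second bracket, multiplied by minus the imaginary unit, is
      \<open>ip u v - ip v u\<close>; so both brackets are symmetric sums of the kind bounded by
      \<open>sym\<close>.\<close>
    have "2 *\<^sub>R ip u v = (ip u v + ip v u) - \<i> *\<^sub>C (ip u ?w + ip ?w u)"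
      by (simp add: ip_scaleC_right ip_scaleC_left scaleC_add_right scaleC_diff_right scaleC_scaleC scaleC_minus_left
          scaleC_one scaleR_2)
    also have "norm \<dots> \<le> norm (ip u v + ip v u) + norm (\<i> *\<^sub>C (ip u ?w + ip ?w u))"
      by (rule norm_triangle_ineq4)
    also have "\<dots> \<le> 6 + 6"
      using sym[OF uv] sym[of u ?w] uv by (intro add_mono) (simp_all add: norm_scaleC)
    finally show ?thesis by simp
  qed
  show ?thesis
  proof (cases "x = 0 \<or> y = 0")
    case True
    then show ?thesis
      using ip_scaleR_left[of 0 x y] ip_scaleR_right[of x 0 y] by auto
  next
    case False
    have "ip x y = (norm x * norm y) *\<^sub>R ip (x /\<^sub>R norm x) (y /\<^sub>R norm y)"
    proof -
      have "norm x * norm y * (inverse (norm x) * inverse (norm y)) = 1" using False by (simp add: field_simps)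
      then show ?thesis by (simp add: ip_scaleR_left ip_scaleR_right mult_ac)
    qed
    then show ?thesis
      using unit[of "x /\<^sub>R norm x" "y /\<^sub>R norm y"] False
      by (simp add: mult.commute mult_left_mono)
  qed
qed

lemma bounded_bilinear_ip: "bounded_bilinear ip"
proof
  show "\<exists>K. \<forall>a b. norm (ip a b) \<le> norm a * norm b * K"
    using norm_ip_le by (intro exI[of _ 6]) (simp add: mult_ac)
qed (simp_all add: ip_add_left ip_add_right ip_scaleR_left ip_scaleR_right)

sublocale ip: bounded_bilinear ip
  by (rule bounded_bilinear_ip)

lemma ip_eqI_right: "(\<And>x. ip x y = ip x z) \<Longrightarrow> y = z"
  using ip_definite[of "y - z"] by (simp add: ip.diff_right ip.diff_left)

lemma ip_eqI_left: "(\<And>x. ip y x = ip z x) \<Longrightarrow> y = z"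
  by (rule ip_eqI_right) (metis star_ip)

lemma ip_eq_0_sym: "ip x y = 0 \<longleftrightarrow> ip y x = 0"
  by (metis star_ip star_zero)

text \<open>A relation, because an operator on a Hilbert module may have no adjoint. Membership in
  such a pair singles out the adjointable operators among the real linear ones.\<close>

definition adjb :: "'e bop \<Rightarrow> 'e bop \<Rightarrow> bool"
  where "adjb a a' \<longleftrightarrow> (\<forall>x y. ip (a \<star> x) y = ip x (a' \<star> y))"

lemma adjbI: "(\<And>x y. ip (a \<star> x) y = ip x (a' \<star> y)) \<Longrightarrow> adjb a a'"
  by (simp add: adjb_def)

lemma adjbD: "adjb a a' \<Longrightarrow> ip (a \<star> x) y = ip x (a' \<star> y)"
  by (simp add: adjb_def)

lemma adjb_sym: "adjb a a' \<Longrightarrow> adjb a' a"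
  unfolding adjb_def by (metis star_ip)

lemma adjb_intros:
  "adjb 0 0" "adjb 1 1"
  "adjb a a' \<Longrightarrow> adjb b b' \<Longrightarrow> adjb (a + b) (a' + b')"
  "adjb a a' \<Longrightarrow> adjb b b' \<Longrightarrow> adjb (a - b) (a' - b')"
  "adjb a a' \<Longrightarrow> adjb (- a) (- a')"
  "adjb a a' \<Longrightarrow> adjb (r *\<^sub>R a) (r *\<^sub>R a')"
  "adjb a a' \<Longrightarrow> adjb b b' \<Longrightarrow> adjb (a * b) (b' * a')"
  by (simp_all add: adjb_def ip.add_left ip.add_right ip.diff_left ip.diff_right ip.minus_left
      ip.minus_right ip.scaleR_left ip.scaleR_right ip.zero_left ip.zero_right)

text \<open>Testing against \<open>ip\<close> transfers complex homogeneity to \<open>a\<close>, of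
  which only real linearity is built into \<open>bop\<close>.\<close>

lemma adjb_scaleC: "adjb a a' \<Longrightarrow> a \<star> (c *\<^sub>C x) = c *\<^sub>C (a \<star> x)"
  by (rule ip_eqI_left) (simp add: adjbD ip_scaleC_left)

text \<open>The norm is read off the diagonal values of \<open>ip\<close>, so the constant
  \<open>6\<close> of \<open>norm_ip_le\<close> does not enter. The sharp norm bounds for positive
  operators rest on this.\<close>

lemma adjb_isometry:
  assumes "adjb u u'" "u' * u = r *\<^sub>R 1" "0 \<le> r"
  shows "norm u \<le> sqrt r"
proof (rule norm_bop_le)
  fix x
  have "ip (u \<star> x) (u \<star> x) = ip x ((u' * u) \<star> x)"
    using assms(1) by (simp add: adjbD)
  also have "\<dots> = r *\<^sub>R ip x x" by (simp add: assms(2) ip.scaleR_right)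
  finally have "(norm (u \<star> x))\<^sup>2 = r * (norm x)\<^sup>2"
    using assms(3) by (simp flip: norm_ip_self)
  also have "\<dots> = (sqrt r * norm x)\<^sup>2" using assms(3) by (simp add: power_mult_distrib)
  finally show "norm (u \<star> x) \<le> sqrt r * norm x"
    using assms(3) by (simp add: power2_eq_iff_nonneg)
qed (simp add: assms(3))

lemma adjb_mult_eq_0:
  assumes "adjb a a'" "a' * a = 0"
  shows "a = 0"
proof (rule bop_eqI)
  fix x
  have "ip (a \<star> x) (a \<star> x) = ip x ((a' * a) \<star> x)" using assms(1) by (simp add: adjbD)
  then show "a \<star> x = 0 \<star> x" using ip_definite assms(2) by (simp add: ip.zero_right)
qed

text \<open>The algebra \<open>bop\<close> has real scalars only, so the imaginary unit enters as an
  operator. It commutes with adjointable operators and anticommutes with conjugate-linear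
  ones.\<close>

definition iop :: "'e bop"
  where "iop = (SOME a. \<forall>x. a \<star> x = \<i> *\<^sub>C x)"

lemma iop [simp]: "iop \<star> x = \<i> *\<^sub>C x"
  using someI_ex[OF bop_of_bounded_linear[OF bounded_linear_scaleC]] unfolding iop_def by blast

lemma iop_adjb: "adjb iop (- iop)"
  by (rule adjbI)
    (simp add: ip_scaleC_left ip_scaleC_right ip.minus_right scaleC_minus_left)

lemma iop_sq: "iop * iop = - 1"
  by (rule bop_eqI) (simp add: scaleC_scaleC scaleC_minus_left scaleC_one)

lemma iop_commute: "adjb a a' \<Longrightarrow> iop * a = a * iop"
  by (rule bop_eqI) (simp add: adjb_scaleC)

section \<open>Self-adjoint operators\<close>

definition sa :: "'e bop \<Rightarrow> bool"
  where "sa a \<longleftrightarrow> adjb a a"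

lemma sa_intros:
  "sa 0" "sa 1" "sa a \<Longrightarrow> sa b \<Longrightarrow> sa (a + b)" "sa a \<Longrightarrow> sa b \<Longrightarrow> sa (a - b)"
  "sa a \<Longrightarrow> sa (- a)" "sa a \<Longrightarrow> sa (r *\<^sub>R a)" "sa a \<Longrightarrow> sa (a * a)"
  by (simp_all add: sa_def adjb_intros)

lemma sa_mult: "sa a \<Longrightarrow> sa b \<Longrightarrow> a * b = b * a \<Longrightarrow> sa (a * b)"
  unfolding sa_def by (metis adjb_intros(7))

lemma sa_sq_eq_0: "sa a \<Longrightarrow> a * a = 0 \<Longrightarrow> a = 0"
  unfolding sa_def by (rule adjb_mult_eq_0)

lemma sa_adjb_mult: "adjb a a' \<Longrightarrow> sa (a' * a)"
  unfolding sa_def by (metis adjb_intros(7) adjb_sym)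

text \<open>Self-adjointness has to survive the limit of the square root iteration. It is an
  intersection of closed conditions, one for each pair of vectors.\<close>

lemma closed_sa: "closed {a. sa a}"
proof -
  have "continuous_on UNIV (\<lambda>a :: 'e bop. a \<star> x)" for x
    by (simp add: bounded_linear_bapp_left linear_continuous_on)
  then have "closed {a :: 'e bop. ip (a \<star> x) y = ip x (a \<star> y)}" for x y
    by (intro closed_Collect_eq ip.continuous_on continuous_on_const)
  then have "closed (\<Inter>x. \<Inter>y. {a :: 'e bop. ip (a \<star> x) y = ip x (a \<star> y)})"
    by blast
  moreover have "{a. sa a} = (\<Inter>x. \<Inter>y. {a :: 'e bop. ip (a \<star> x) y = ip x (a \<star> y)})"
    by (auto simp: sa_def adjb_def)
  ultimately show ?thesis by simp
qed

subsection \<open>The positive cone and square roots\<close>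

text \<open>
  Positivity without spectra: the condition says that the spectrum lies in \<open>{0..2 * t}\<close>. It makes
  the positive elements a cone at once.
\<close>

definition pos :: "'e bop \<Rightarrow> bool"
  where "pos a \<longleftrightarrow> sa a \<and> (\<exists>t\<ge>0. norm (t *\<^sub>R 1 - a) \<le> t)"

lemma pos_sa: "pos a \<Longrightarrow> sa a"
  by (simp add: pos_def)

lemma pos_upward:
  assumes "norm (t *\<^sub>R 1 - a) \<le> t" "t \<le> (s :: real)"
  shows "norm (s *\<^sub>R 1 - a :: 'e bop) \<le> s"
proof -
  have "s *\<^sub>R 1 - a = (s - t) *\<^sub>R 1 + (t *\<^sub>R 1 - a)" by (simp add: algebra_simps)
  also have "norm \<dots> \<le> (s - t) + t"
    using assms norm_scaleR_one_bop_le[of "s - t"] by (intro norm_triangle_mono) simp_all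
  finally show ?thesis by simp
qed

text \<open>Replacing a witness \<open>t\<close> by \<open>t + 1\<close> makes it strictly positive,
  so that one can divide by it.\<close>

lemma posE:
  assumes "pos a"
  obtains t where "0 < t" "norm (t *\<^sub>R 1 - a) \<le> t" "norm a \<le> 2 * t"
proof -
  from assms obtain t where t: "0 \<le> t" "norm (t *\<^sub>R 1 - a) \<le> t" by (auto simp: pos_def)
  show ?thesis
  proof
    show 1: "norm ((t + 1) *\<^sub>R 1 - a) \<le> t + 1" using pos_upward[OF t(2)] by simp
    have "norm a = norm ((t + 1) *\<^sub>R 1 - ((t + 1) *\<^sub>R 1 - a))" by simp
    also have "\<dots> \<le> norm ((t + 1) *\<^sub>R 1 :: 'e bop) + norm ((t + 1) *\<^sub>R 1 - a)"
      by (rule norm_triangle_ineq4)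
    also have "\<dots> \<le> (t + 1) + (t + 1)"
      using 1 t by (intro add_mono norm_scaleR_one_bop_le) simp
    finally show "norm a \<le> 2 * (t + 1)" by simp
  qed (use t in simp)
qed

lemma pos_0: "pos 0"
  by (auto simp: pos_def sa_intros intro: exI[of _ 0])

lemma pos_add:
  assumes "pos a" "pos b"
  shows "pos (a + b)"
proof -
  from assms obtain s t where s: "0 \<le> s" "norm (s *\<^sub>R 1 - a) \<le> s" and t: "0 \<le> t" "norm (t *\<^sub>R 1 - b) \<le> t"
    by (auto simp: pos_def)
  have "(s + t) *\<^sub>R 1 - (a + b) = (s *\<^sub>R 1 - a) + (t *\<^sub>R 1 - b)" by (simp add: algebra_simps)
  then have "norm ((s + t) *\<^sub>R 1 - (a + b)) \<le> s + t"
    using norm_triangle_mono[OF s(2) t(2)] by (simp only:)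
  with s t assms show ?thesis unfolding pos_def by (auto simp: sa_intros intro!: exI[of _ "s + t"])
qed

lemma pos_scaleR:
  assumes "pos a" "0 \<le> r"
  shows "pos (r *\<^sub>R a)"
proof -
  from assms obtain t where t: "0 \<le> t" "norm (t *\<^sub>R 1 - a) \<le> t" by (auto simp: pos_def)
  have "(r * t) *\<^sub>R 1 - r *\<^sub>R a = r *\<^sub>R (t *\<^sub>R 1 - a)" by (simp add: algebra_simps)
  then have "norm ((r * t) *\<^sub>R 1 - r *\<^sub>R a) \<le> r * t"
    using t assms by (simp only: norm_scaleR) (simp add: mult_left_mono)
  with t assms show ?thesis unfolding pos_def by (auto simp: sa_intros intro!: exI[of _ "r * t"])
qed

lemma pos_norm_diff: "sa a \<Longrightarrow> norm a \<le> r \<Longrightarrow> pos (r *\<^sub>R 1 - a)"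
  by (auto simp: pos_def sa_intros intro!: exI[of _ r] intro: order.trans[OF norm_ge_zero])

text \<open>After division by \<open>t\<close>, \<open>banach_algebra_sqrt\<close> applies. Its
  clause on \<open>Q\<close> is used for the self-adjoint operators and for the commutant of each
  \<open>b\<close>; the second use makes roots of commuting operators commute.\<close>

lemma pos_sqrt:
  assumes "pos a"
  shows "\<exists>c. pos c \<and> c * c = a \<and> (\<forall>b. a * b = b * a \<longrightarrow> c * b = b * c)"
proof -
  from assms obtain t where t: "0 < t" "norm (t *\<^sub>R 1 - a) \<le> t" by (rule posE)
  have "1 - (1/t) *\<^sub>R a = (1/t) *\<^sub>R (t *\<^sub>R 1 - a)" using t by (simp add: algebra_simps)
  then have "norm (1 - (1/t) *\<^sub>R a) \<le> 1" using t by simp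
  then obtain r where r: "r * r = (1/t) *\<^sub>R a" "norm (1 - r) \<le> 1" and
    Q: "\<forall>Q. closed Q \<longrightarrow> 1 \<in> Q \<longrightarrow> (1/t) *\<^sub>R a \<in> Q \<longrightarrow> (\<forall>x\<in>Q. \<forall>y\<in>Q. x + y \<in> Q) \<longrightarrow>
      (\<forall>t. \<forall>x\<in>Q. t *\<^sub>R x \<in> Q) \<longrightarrow> (\<forall>x\<in>Q. x * x \<in> Q) \<longrightarrow> r \<in> Q"
    using banach_algebra_sqrt[of "(1/t) *\<^sub>R a"] by blast
  have "r \<in> {a. sa a}"
    using pos_sa[OF assms] by (intro Q[rule_format]) (simp_all add: closed_sa sa_intros)
  then have "pos r" using r unfolding pos_def by (auto intro!: exI[of _ 1])
  show ?thesis
  proof (intro exI[of _ "sqrt t *\<^sub>R r"] conjI allI impI)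
    show "pos (sqrt t *\<^sub>R r)" using \<open>pos r\<close> t by (simp add: pos_scaleR)
    show "(sqrt t *\<^sub>R r) * (sqrt t *\<^sub>R r) = a" using r t by simp
    fix b assume b: "a * b = b * a"
    have sq: "x * x * b = b * (x * x)" if "x * b = b * x" for x
      by (metis that mult.assoc)
    have "r \<in> {x. x * b = b * x}"
    proof (rule Q[rule_format])
      show "closed {x. x * b = b * x}" by (intro closed_Collect_eq continuous_intros)
    qed (auto simp: b sq distrib_left distrib_right)
    then show "(sqrt t *\<^sub>R r) * b = b * (sqrt t *\<^sub>R r)" by simp
  qed
qed

text \<open>Here \<open>c + \<i> d\<close> is a multiple of a unitary, and unitaries preserve the inner product.\<close>

lemma norm_le_sqrt:
  assumes "sa c" "sa d" "c * d = d * c" "c * c + d * d = r *\<^sub>R 1" "0 \<le> r"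
  shows "norm c \<le> sqrt r"
proof -
  have ci: "c * iop = iop * c" and di: "d * iop = iop * d"
    using assms(1,2) iop_commute unfolding sa_def by metis+
  define u where "u = c + iop * d"
  define v where "v = c - iop * d"
  have adj: "adjb u v"
  proof -
    have "adjb (c + iop * d) (c + d * - iop)"
      using assms by (intro adjb_intros iop_adjb) (simp_all add: sa_def)
    then show ?thesis by (simp add: u_def v_def di)
  qed
  have 1: "c * (iop * d) = iop * d * c"
    using assms(3) by (metis ci mult.assoc)
  have 2: "(iop * d) * (iop * d) = - (d * d)"
  proof -
    have "(iop * d) * (iop * d) = iop * (d * iop) * d" by (simp only: mult.assoc)
    also have "\<dots> = (iop * iop) * (d * d)" by (simp only: di mult.assoc)
    finally show ?thesis by (simp add: iop_sq)
  qed
  have "v * u = c * c + d * d" "u * v = c * c + d * d"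
    unfolding u_def v_def by (simp_all only: distrib_left distrib_right left_diff_distrib
        right_diff_distrib 1 2) simp_all
  then have "v * u = r *\<^sub>R 1" "u * v = r *\<^sub>R 1"
    using assms(4) by simp_all
  then have "norm u \<le> sqrt r" "norm v \<le> sqrt r"
    using adj adjb_sym assms(5) adjb_isometry by blast+
  moreover have "c = (1/2) *\<^sub>R (u + v)" by (simp add: u_def v_def flip: scaleR_2)
  ultimately show ?thesis using norm_triangle_ineq[of u v] by simp
qed

text \<open>Scale \<open>c\<close> to \<open>e\<close> of norm at most \<open>1\<close> and let
  \<open>d\<close> be a root of \<open>1 - e * e\<close>. Then \<open>d\<close> and \<open>e\<close>
  commute and their squares add up to \<open>1\<close>, so \<open>norm_le_sqrt\<close> bounds
  \<open>d\<close> by \<open>1\<close>. Hence \<open>norm (1 - e * e)\<close> is at most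
  \<open>1\<close>, which is positivity of \<open>e * e\<close> with witness
  \<open>1\<close>.\<close>

lemma pos_sq:
  assumes "sa c"
  shows "pos (c * c)"
proof -
  \<comment> \<open>The summand \<open>1\<close> covers the case \<open>c = 0\<close>.\<close>
  define s where "s = 1 / (norm c + 1)"
  have s: "0 < s" "s * norm c \<le> 1" by (simp_all add: s_def add_nonneg_pos)
  define e where "e = s *\<^sub>R c"
  have e: "sa e" "norm e \<le> 1" using s assms by (simp_all add: e_def sa_intros)
  then have "norm (e * e) \<le> 1"
    using norm_square_le[of e 1] by simp
  then have "pos (1 - e * e)" using pos_norm_diff[of "e * e" 1] e by (simp add: sa_intros)
  then obtain d where d: "pos d" "d * d = 1 - e * e"
      "\<forall>b. (1 - e * e) * b = b * (1 - e * e) \<longrightarrow> d * b = b * d"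
    using pos_sqrt[OF \<open>pos (1 - e * e)\<close>] by blast
  have "d * e = e * d" using d(3) by (simp add: algebra_simps)
  then have "norm d \<le> sqrt 1"
    by (intro norm_le_sqrt[OF pos_sa[OF d(1)] e(1)]) (simp_all only: d(2), simp_all)
  then have "norm (1 - e * e) \<le> 1"
    using norm_square_le[of d 1] by (simp add: d(2))
  then have "pos (e * e)" using e unfolding pos_def by (auto simp: sa_intros intro!: exI[of _ 1])
  then have "pos ((1 / s\<^sup>2) *\<^sub>R (e * e))" by (intro pos_scaleR) simp_all
  then show ?thesis using s by (simp add: e_def power2_eq_square)
qed

text \<open>The roots of \<open>a\<close> and of \<open>r *\<^sub>R 1 - a\<close> commute and their
  squares add up to \<open>r *\<^sub>R 1\<close>, so \<open>norm_le_sqrt\<close> bounds the first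
  root by \<open>sqrt r\<close>.\<close>

lemma pos_norm_le:
  assumes "pos a" "pos (r *\<^sub>R 1 - a)" "0 \<le> r"
  shows "norm a \<le> r"
proof -
  obtain c where c: "pos c" "c * c = a" "\<forall>b. a * b = b * a \<longrightarrow> c * b = b * c"
    using pos_sqrt[OF assms(1)] by (elim exE conjE) (rule that)
  obtain d where d: "pos d" "d * d = r *\<^sub>R 1 - a"
      "\<forall>b. (r *\<^sub>R 1 - a) * b = b * (r *\<^sub>R 1 - a) \<longrightarrow> d * b = b * d"
    using pos_sqrt[OF assms(2)] by (elim exE conjE) (rule that)
  have "d * a = a * d" using d(3) by (simp add: algebra_simps)
  then have "c * d = d * c" using c(3) by metis
  then have "norm c \<le> sqrt r"
    by (intro norm_le_sqrt[OF pos_sa[OF c(1)] pos_sa[OF d(1)]] assms(3)) (simp_all only: c(2) d(2), simp)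
  then show ?thesis
    using norm_square_le[of c "sqrt r"] assms(3) by (simp add: c(2))
qed

lemma pos_norm_mono:
  assumes "pos a" "pos (b - a)"
  shows "norm a \<le> norm b"
proof (rule pos_norm_le)
  have "sa b" using sa_intros(3)[OF pos_sa[OF assms(1)] pos_sa[OF assms(2)]] by simp
  then have "pos ((norm b *\<^sub>R 1 - b) + (b - a))" by (intro pos_add pos_norm_diff assms) simp_all
  then show "pos (norm b *\<^sub>R 1 - a)" by simp
qed (simp_all add: assms)

lemma pos_antisym: "pos a \<Longrightarrow> pos (- a) \<Longrightarrow> a = 0"
  using pos_norm_le[of a 0] by simp

text \<open>Roots of commuting operators commute, so the product is the square of the self-adjoint
  operator \<open>c * d\<close>.\<close>

lemma pos_mult:
  assumes "pos a" "pos b" "a * b = b * a"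
  shows "pos (a * b)"
proof -
  obtain c where c: "pos c" "c * c = a" "\<forall>b. a * b = b * a \<longrightarrow> c * b = b * c"
    using pos_sqrt[OF assms(1)] by (elim exE conjE) (rule that)
  obtain d where d: "pos d" "d * d = b" "\<forall>x. b * x = x * b \<longrightarrow> d * x = x * d"
    using pos_sqrt[OF assms(2)] by (elim exE conjE) (rule that)
  have "c * b = b * c" using c(3) assms(3) by blast
  then have cd: "c * d = d * c" using d(3) by metis
  have "a * b = (c * d) * (c * d)"
    unfolding c(2)[symmetric] d(2)[symmetric] by (metis cd mult.assoc)
  then show ?thesis using pos_sq[OF sa_mult[OF pos_sa[OF c(1)] pos_sa[OF d(1)] cd]] by simp
qed

lemma pos_1: "pos 1"
  using pos_sq[OF sa_intros(2)] by simp

lemma pos_power: "pos a \<Longrightarrow> pos (a ^ n)"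
  by (induction n) (simp_all add: pos_1 pos_mult power_commutes)

subsection \<open>Positivity of \<open>b\<^sup>* b\<close> and its consequences\<close>

lemma pos_one_plus_power:
  assumes "pos p"
  shows "pos ((1 + p) ^ n - 1)"
proof (induction n)
  case (Suc n)
  have "(1 + p) ^ n * p = p * (1 + p) ^ n"
    by (rule power_commuting_commutes) (simp add: algebra_simps)
  then have "pos (p * (1 + p) ^ n)"
    using assms by (intro pos_mult pos_power pos_add pos_1) simp_all
  from pos_add[OF Suc this] show ?case by (simp add: algebra_simps)
qed (simp add: pos_0)

text \<open>A Bernoulli-type estimate: each step adds \<open>p * p * (1 + p) ^ n\<close>, which
  dominates \<open>p * p\<close> by \<open>pos_one_plus_power\<close>.\<close>

lemma pos_mult_one_plus_power:
  assumes "pos p"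
  shows "pos (p * (1 + p) ^ n - real n *\<^sub>R (p * p))"
proof (induction n)
  case 0 show ?case using assms by simp
next
  case (Suc n)
  have "(1 + p) ^ n * (p * p) = (p * p) * (1 + p) ^ n"
    by (rule power_commuting_commutes) (simp add: algebra_simps)
  then have "pos ((p * p) * ((1 + p) ^ n - 1))"
    using assms by (intro pos_mult pos_one_plus_power) (simp_all add: pos_sa algebra_simps)
  from pos_add[OF Suc this] show ?case by (simp add: algebra_simps)
qed

text \<open>Writing \<open>z\<close> as \<open>x + iop * y\<close> with \<open>x\<close> and
  \<open>y\<close> self-adjoint, the sum is twice \<open>x * x + y * y\<close>. The proof works with
  the operators \<open>z + z'\<close> and \<open>iop * (z - z')\<close>, which are \<open>x\<close>
  and \<open>y\<close> up to real factors.\<close>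

lemma pos_mult_adjb_add:
  assumes "adjb z z'"
  shows "pos (z' * z + z * z')"
proof -
  have s: "sa (z + z')" "sa (iop * (z - z'))"
  proof -
    have d: "adjb (z - z') (z' - z)" by (intro adjb_intros assms adjb_sym[OF assms])
    from adjb_intros(7)[OF iop_adjb this]
    have "adjb (iop * (z - z')) ((z - z') * iop)" by (simp add: algebra_simps)
    then show "sa (iop * (z - z'))" by (simp add: sa_def iop_commute[OF d])
    show "sa (z + z')"
      unfolding sa_def using adjb_intros(3)[OF assms adjb_sym[OF assms]] by (simp add: add.commute)
  qed
  have "(iop * (z - z')) * (iop * (z - z')) = iop * ((z - z') * iop) * (z - z')"
    by (simp only: mult.assoc)
  also have "\<dots> = (iop * iop) * ((z - z') * (z - z'))"
    by (simp only: iop_commute[OF adjb_intros(4)[OF assms adjb_sym[OF assms]], symmetric] mult.assoc)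
  finally have "(z + z') * (z + z') + (iop * (z - z')) * (iop * (z - z')) = 2 *\<^sub>R (z' * z + z * z')"
    by (simp add: iop_sq algebra_simps scaleR_2)
  moreover have "pos ((z + z') * (z + z') + (iop * (z - z')) * (iop * (z - z')))"
    using s by (intro pos_add pos_sq)
  ultimately show ?thesis using pos_scaleR[of "2 *\<^sub>R (z' * z + z * z')" "1/2"] by simp
qed

lemma norm_power_mult_le:
  fixes x :: "'e bop"
  assumes "norm x \<le> 1"
  shows "norm (x ^ n * y) \<le> norm y"
proof (induction n)
  case (Suc n)
  have "norm (x ^ Suc n * y) \<le> norm x * norm (x ^ n * y)"
    using norm_mult_ineq[of x "x ^ n * y"] by (simp add: mult.assoc)
  also have "\<dots> \<le> 1 * norm y" using assms Suc by (intro mult_mono) simp_all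
  finally show ?case by simp
qed simp

text \<open>
  With \<open>p = - (z' * z)\<close> and \<open>q = z * z'\<close> scaled so that \<open>norm (1 - q) \<le> 1\<close>, the intertwining
  \<open>z * (1 + p) ^ n = (1 - q) ^ n * z\<close> keeps \<open>p * (1 + p) ^ n\<close> bounded, although it dominates
  \<open>n *\<^sub>R (p * p)\<close>.
\<close>

lemma neg_mult_adjb_eq_0:
  assumes z: "adjb z z'" and neg: "pos (- (z' * z))"
  shows "z' * z = 0"
proof -
  \<comment> \<open>The sign hypothesis turns the symmetric sum into positivity of
    \<open>z * z'\<close>, which provides the scaling factor \<open>t\<close>.\<close>
  have "pos ((z' * z + z * z') + - (z' * z))" by (intro pos_add pos_mult_adjb_add z neg)
  then have "pos (z * z')" by simp
  then obtain t where t: "0 < t" "norm (t *\<^sub>R 1 - z * z') \<le> t" by (rule posE)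
  define w where "w = (1 / sqrt t) *\<^sub>R z"
  define w' where "w' = (1 / sqrt t) *\<^sub>R z'"
  define p where "p = - (w' * w)"
  define q where "q = w * w'"
  have ww: "w' * w = (1/t) *\<^sub>R (z' * z)" "q = (1/t) *\<^sub>R (z * z')"
    using t by (simp_all add: w_def w'_def q_def)
  have p: "pos p" using pos_scaleR[OF neg, of "1/t"] t by (simp add: p_def ww)
  have "1 - q = (1/t) *\<^sub>R (t *\<^sub>R 1 - z * z')" using t by (simp add: ww algebra_simps)
  then have q: "norm (1 - q) \<le> 1" using t by simp
  have inter: "w * (1 + p) ^ n = (1 - q) ^ n * w" for n
  proof (induction n)
    case (Suc n)
    have *: "w * (1 + p) = (1 - q) * w" by (simp add: p_def q_def algebra_simps)
    have "w * (1 + p) ^ Suc n = (w * (1 + p)) * (1 + p) ^ n" by (simp add: mult.assoc)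
    also have "\<dots> = (1 - q) * w * (1 + p) ^ n" by (simp only: *)
    also have "\<dots> = (1 - q) ^ Suc n * w" by (simp only: Suc mult.assoc power_Suc)
    finally show ?case .
  qed simp
  have "norm (p * p) \<le> norm w' * norm w / real n" if "n > 0" for n
  proof -
    have "p * (1 + p) ^ n = - (w' * ((1 - q) ^ n * w))"
      by (simp add: p_def mult.assoc flip: inter)
    then have "norm (p * (1 + p) ^ n) \<le> norm w' * norm w"
      using norm_mult_ineq[of w' "(1 - q) ^ n * w"] mult_left_mono[OF norm_power_mult_le[OF q, of n w], of "norm w'"]
      by simp
    moreover have "norm (real n *\<^sub>R (p * p)) \<le> norm (p * (1 + p) ^ n)"
      using p by (intro pos_norm_mono pos_mult_one_plus_power pos_scaleR pos_sq pos_sa) simp_all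
    ultimately show ?thesis using that by (simp add: field_simps)
  qed
  then have "norm (p * p) \<le> 0"
    by (intro LIMSEQ_le_const[OF lim_const_over_n[of "norm w' * norm w"]]) (auto intro!: exI[of _ 1])
  then have "p = 0" using sa_sq_eq_0[OF pos_sa[OF p]] by simp
  then show ?thesis using t by (simp add: p_def ww)
qed

text \<open>
  With \<open>a = b' * b\<close> and \<open>x = |a| - a\<close>, the element \<open>z = b * x * |a|\<^sup>1\<^sup>/\<^sup>2\<close> has
  \<open>z\<^sup>* z = - (|a| x)\<^sup>2\<close>, hence vanishes.
\<close>

lemma pos_mult_adjb:
  assumes b: "adjb b b'"
  shows "pos (b' * b)"
proof -
  define a where "a = b' * b"
  have a: "sa a" unfolding a_def by (rule sa_adjb_mult[OF b])
  obtain m where m: "pos m" "m * m = a * a" "\<forall>x. a * a * x = x * (a * a) \<longrightarrow> m * x = x * m"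
    using pos_sqrt[OF pos_sq[OF a]] by (elim exE conjE) (rule that)
  have ma: "m * a = a * m" using m(3) by (simp add: mult.assoc)
  obtain k where k: "pos k" "k * k = m" "\<forall>x. m * x = x * m \<longrightarrow> k * x = x * k"
    using pos_sqrt[OF m(1)] by (elim exE conjE) (rule that)
  have ka: "k * a = a * k" using k(3) ma by blast
  have km: "k * m = m * k" using k(3) by blast
  \<comment> \<open>Twice the negative part of \<open>a\<close>; the aim is to show that it
    vanishes.\<close>
  define x where "x = m - a"
  have x: "sa x" unfolding x_def by (intro sa_intros a pos_sa m(1))
  have kx: "k * x = x * k" by (simp add: x_def ka km algebra_simps)
  have mx: "m * x = x * m" by (simp add: x_def ma algebra_simps)
  have ax: "a * x = - (m * x)" by (simp add: x_def m(2) ma algebra_simps)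
  have smx: "sa (m * x)" by (intro sa_mult x pos_sa m(1) mx)
  have z: "adjb (b * x * k) (k * (x * b'))"
    using x pos_sa[OF k(1)] unfolding sa_def by (intro adjb_intros b)
  have "k * (x * b') * (b * x * k) = k * x * (a * x) * k"
    by (simp only: a_def mult.assoc)
  also have "\<dots> = - (k * x * m * x * k)"
    by (simp add: ax mult.assoc)
  also have "k * x * m * x * k = x * (k * m) * (x * k)"
    by (simp only: kx mult.assoc)
  also have "\<dots> = x * m * (k * k) * x"
    by (simp only: km kx[symmetric] mult.assoc)
  also have "\<dots> = (m * x) * (m * x)"
    by (simp only: k(2) mx mult.assoc)
  finally have zz: "k * (x * b') * (b * x * k) = - ((m * x) * (m * x))" .
  have "k * (x * b') * (b * x * k) = 0"
    by (rule neg_mult_adjb_eq_0[OF z]) (simp add: zz pos_sq smx)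
  then have "m * x = 0" using zz smx sa_sq_eq_0 by simp
  have "x * x = m * x - a * x" by (simp add: x_def left_diff_distrib)
  also have "\<dots> = 0" by (simp only: ax \<open>m * x = 0\<close>) simp
  finally have "x * x = 0" .
  then have "x = 0" by (rule sa_sq_eq_0[OF x])
  then show ?thesis using m(1) by (simp add: x_def a_def)
qed

text \<open>For \<open>d = a - c\<close> the positive operators \<open>d * d * a\<close> and
  \<open>d * d * c\<close> add up to zero, since \<open>d * (a + c) = 0\<close>. So both vanish, and
  with them the cube of \<open>d\<close>, which forces \<open>d = 0\<close> by
  self-adjointness.\<close>

lemma pos_sqrt_unique_commuting:
  assumes "pos a" "pos c" "a * a = c * c" "a * c = c * a"
  shows "a = c"
proof -
  define d where "d = a - c"
  have d: "sa d" using assms pos_sa by (simp add: d_def sa_intros)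
  have da: "d * a = a * d" and dc: "d * c = c * d"
    unfolding d_def using assms(4) by (simp_all add: algebra_simps)
  then have "(d * d) * a = a * (d * d)" "(d * d) * c = c * (d * d)"
    by (metis da dc mult.assoc)+
  then have p: "pos (d * d * a)" "pos (d * d * c)" by (intro pos_mult pos_sq d assms; simp)+
  have "d * (a + c) = 0" using assms(3,4) by (simp add: d_def algebra_simps)
  then have "d * d * a + d * d * c = 0" by (simp only: mult.assoc flip: distrib_left) simp
  then have "d * d * a = - (d * d * c)" by (simp add: eq_neg_iff_add_eq_0)
  then have "d * d * c = 0" "d * d * a = 0" using pos_antisym p by force+
  then have "d * d * d = 0" by (simp add: d_def right_diff_distrib)
  then have "(d * d) * (d * d) = 0" by (simp flip: mult.assoc)
  then have "d = 0" using sa_sq_eq_0 d sa_intros(7) by blast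
  then show ?thesis by (simp add: d_def)
qed

text \<open>Both roots are compared with the one from \<open>pos_sqrt\<close>, which commutes with
  everything that commutes with \<open>a * a\<close>, in particular with \<open>a\<close> and
  \<open>b\<close>.\<close>

lemma pos_sqrt_unique:
  assumes "pos a" "pos b" "a * a = b * b"
  shows "a = b"
proof -
  obtain c where c: "pos c" "c * c = a * a" "\<forall>x. a * a * x = x * (a * a) \<longrightarrow> c * x = x * c"
    using pos_sqrt[OF pos_sq[OF pos_sa[OF assms(1)]]] by (elim exE conjE) (rule that)
  have "c * a = a * c" using c(3) by (simp add: mult.assoc)
  moreover have "c * b = b * c" using c(3) by (simp add: assms(3) mult.assoc)
  ultimately show ?thesis
    using pos_sqrt_unique_commuting[OF c(1)] c(2) assms by metis
qed

text \<open>The operator form of \<open>m * x * (1 - x) ^ m \<le> 1\<close> on the unit interval.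
  The induction compares \<open>n * g * (1 - g) ^ n\<close> with \<open>1 - (1 - g) ^ n\<close>; the
  gap grows by \<open>(n + 1) * g * g * (1 - g) ^ n\<close> at each step.\<close>

lemma norm_mult_power_compl_le:
  assumes g: "pos g" "norm g \<le> 1"
  shows "real m * norm (g * (1 - g) ^ m) \<le> 1"
proof -
  have h: "pos (1 - g)" using pos_norm_diff[OF pos_sa[OF g(1)] g(2)] by simp
  have comm: "(1 - g) ^ n * g = g * (1 - g) ^ n" for n
    by (rule power_commuting_commutes) (simp add: algebra_simps)
  have comm2: "(1 - g) ^ n * (g * g) = (g * g) * (1 - g) ^ n" for n
    by (rule power_commuting_commutes) (simp add: algebra_simps)
  have "pos (1 - (1 - g) ^ n - real n *\<^sub>R (g * (1 - g) ^ n))" for n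
  proof (induction n)
    case 0 show ?case by (simp add: pos_0)
  next
    case (Suc n)
    have "pos (real (Suc n) *\<^sub>R ((g * g) * (1 - g) ^ n))"
      using g h by (intro pos_scaleR pos_mult pos_power comm2[symmetric]) (simp_all add: pos_sq pos_sa)
    from pos_add[OF Suc this] show ?case by (simp add: algebra_simps)
  qed
  from pos_add[OF this[of m] pos_power[OF h, of m]]
  have "pos (1 *\<^sub>R 1 - real m *\<^sub>R (g * (1 - g) ^ m))" by (simp add: algebra_simps)
  then have "norm (real m *\<^sub>R (g * (1 - g) ^ m)) \<le> 1"
    using g h by (intro pos_norm_le pos_scaleR pos_mult pos_power comm[symmetric]) simp_all
  then show ?thesis by simp
qed

text \<open>
  With \<open>g\<close> a multiple of \<open>s * s'\<close> and \<open>h = 1 - g\<close>, the vectors \<open>s' \<star> (1 - h ^ n) \<star> y\<close> lie in the range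
  of \<open>s' * s\<close> and tend to \<open>s' \<star> y\<close>.
\<close>

lemma adjb_in_closure_range:
  assumes s: "adjb s s'"
  shows "s' \<star> y \<in> closure (range (\<lambda>x. s' \<star> s \<star> x))"
proof -
  have G: "pos (s * s')" by (rule pos_mult_adjb[OF adjb_sym[OF s]])
  then obtain t where t: "0 < t" "norm (s * s') \<le> 2 * t" by (rule posE)
  define g where "g = (1 / (2 * t)) *\<^sub>R (s * s')"
  define h where "h = 1 - g"
  have g: "pos g" "norm g \<le> 1" using G t by (simp_all add: g_def pos_scaleR)
  have h: "sa (h ^ n)" for n
    using pos_norm_diff[OF pos_sa[OF g(1)] g(2)] by (auto simp: h_def intro: pos_sa pos_power)
  have ss: "s * s' = (2 * t) *\<^sub>R g" using t by (simp add: g_def)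
  \<comment> \<open>The factor \<open>12 * t\<close> is \<open>2 * t\<close> from the scaling times
    the \<open>6\<close> of \<open>norm_ip_le\<close>. The powers of \<open>h\<close> on both sides
    combine to exponent \<open>n + n\<close>, and the resulting decay is weakened to
    \<open>1 / n\<close>.\<close>
  have bound: "(norm (s' \<star> h ^ n \<star> y))\<^sup>2 \<le> 12 * t * (norm y)\<^sup>2 / real n" if "n > 0" for n
  proof -
    have "h ^ n * g = g * h ^ n"
      unfolding h_def by (rule power_commuting_commutes) (simp add: algebra_simps)
    then have "h ^ n * ((s * s') * h ^ n) = (2 * t) *\<^sub>R (g * h ^ (n + n))"
      by (simp add: ss power_add flip: mult.assoc)
    then have eq: "h ^ n \<star> s \<star> s' \<star> h ^ n \<star> y = (2 * t) *\<^sub>R ((g * h ^ (n + n)) \<star> y)"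
      by (metis bapp_simps(6,7))
    have "ip (s' \<star> h ^ n \<star> y) (s' \<star> h ^ n \<star> y) = ip y (h ^ n \<star> s \<star> s' \<star> h ^ n \<star> y)"
      by (simp add: adjbD[OF adjb_sym[OF s]] adjbD[OF h[unfolded sa_def]])
    then have "(norm (s' \<star> h ^ n \<star> y))\<^sup>2 = 2 * t * norm (ip y ((g * h ^ (n + n)) \<star> y))"
      using t by (simp only: eq ip.scaleR_right flip: norm_ip_self) simp
    also have "\<dots> \<le> 2 * t * (6 * (norm y * (1 / real n * norm y)))"
    proof -
      have "real n * norm (g * h ^ (n + n)) \<le> real (n + n) * norm (g * h ^ (n + n))"
        by (intro mult_right_mono) simp_all
      also have "\<dots> \<le> 1" unfolding h_def by (rule norm_mult_power_compl_le[OF g])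
      finally have "norm (g * h ^ (n + n)) \<le> 1 / real n" using that by (simp add: field_simps)
      then have "norm ((g * h ^ (n + n)) \<star> y) \<le> 1 / real n * norm y"
        by (rule order.trans[OF norm_bapp mult_right_mono]) simp
      then have "6 * (norm y * norm ((g * h ^ (n + n)) \<star> y)) \<le> 6 * (norm y * (1 / real n * norm y))"
        by (intro mult_left_mono) simp_all
      then have "norm (ip y ((g * h ^ (n + n)) \<star> y)) \<le> 6 * (norm y * (1 / real n * norm y))"
        by (rule order.trans[OF norm_ip_le])
      then show ?thesis by (rule mult_left_mono) (use t in simp)
    qed
    finally show ?thesis by (simp add: power2_eq_square algebra_simps)
  qed
  have "(\<lambda>n. (norm (s' \<star> h ^ n \<star> y))\<^sup>2) \<longlonglongrightarrow> 0"
    by (rule tendsto_sandwich[OF _ _ tendsto_const lim_const_over_n[of "12 * t * (norm y)\<^sup>2"]])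
      (auto intro!: eventually_sequentiallyI[of 1] bound)
  then have "(\<lambda>n. s' \<star> h ^ n \<star> y) \<longlonglongrightarrow> 0"
    using tendsto_real_sqrt tendsto_norm_zero_cancel by fastforce
  then have lim: "(\<lambda>n. s' \<star> y - s' \<star> h ^ n \<star> y) \<longlonglongrightarrow> s' \<star> y"
    using tendsto_diff[OF tendsto_const] by fastforce
  \<comment> \<open>Being a left multiple of \<open>g\<close>, the operator \<open>1 - h ^ n\<close>
    is one of \<open>s * s'\<close>, and \<open>s' * (s * s')\<close> maps into the range of
    \<open>s' * s\<close>.\<close>
  have "\<exists>w. 1 - h ^ n = g * w" for n
  proof (induction n)
    case 0 show ?case by (auto intro: exI[of _ 0])
  next
    case (Suc n)
    then obtain w where "1 - h ^ n = g * w" ..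
    then have "1 - h ^ Suc n = g * (w + h ^ n)" by (simp add: h_def algebra_simps)
    then show ?case ..
  qed
  then obtain w where w: "1 - h ^ n = g * w n" for n by metis
  have "s' \<star> y - s' \<star> h ^ n \<star> y = s' \<star> s \<star> ((1 / (2 * t)) *\<^sub>R (s' \<star> w n \<star> y))" for n
  proof -
    have "s' \<star> y - s' \<star> h ^ n \<star> y = s' \<star> ((1 - h ^ n) \<star> y)" by (simp add: bapp_linear)
    then show ?thesis by (simp add: w g_def bapp_linear)
  qed
  then have "s' \<star> y - s' \<star> h ^ n \<star> y \<in> range (\<lambda>x. s' \<star> s \<star> x)" for n by auto
  then show ?thesis
    using lim unfolding closure_sequential by (intro exI[of _ "\<lambda>n. s' \<star> y - s' \<star> h ^ n \<star> y"]) blast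
qed

subsection \<open>The modulus and the polar isometry\<close>

lemma is_adjoint_sym: "is_adjoint ip f g \<Longrightarrow> is_adjoint ip g f"
  unfolding is_adjoint_def by (metis star_ip)

lemma adj_eq:
  assumes "is_adjoint ip f g"
  shows "adj ip f = g"
  unfolding adj_def
proof (rule the_equality)
  fix h assume "is_adjoint ip f h"
  then show "h = g"
    using assms unfolding is_adjoint_def by (metis ext ip_eqI_right)
qed (rule assms)

lemma LL_bapp:
  assumes "adjb a a'"
  shows "(\<star>) a \<in> LL ip" and adj_bapp: "adj ip ((\<star>) a) = (\<star>) a'"
proof -
  have a: "is_adjoint ip ((\<star>) a) ((\<star>) a')" using assms by (simp add: is_adjoint_def adjbD)
  show "(\<star>) a \<in> LL ip"
    using a by (auto simp: LL_def complex_linear_def bapp_linear adjb_scaleC[OF assms])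
  show "adj ip ((\<star>) a) = (\<star>) a'" by (rule adj_eq[OF a])
qed

lemma is_adjoint_bounded_linear:
  assumes fg: "is_adjoint ip f g" and K: "\<And>x. norm (f x) \<le> K * norm x"
  shows "bounded_linear f"
proof (rule bounded_linear_intro)
  have f: "ip (f x) y = ip x (g y)" for x y using fg by (simp add: is_adjoint_def)
  show "f (x + y) = f x + f y" for x y by (rule ip_eqI_left) (simp add: f ip.add_left)
  show "f (r *\<^sub>R x) = r *\<^sub>R f x" for r x by (rule ip_eqI_left) (simp add: f ip.scaleR_left)
  show "norm (f x) \<le> norm x * K" for x using K by (simp add: mult.commute)
qed

text \<open>Testing \<open>g y\<close> against itself gives the bound directly, without the uniform
  boundedness principle.\<close>

lemma is_adjoint_bounded:
  assumes fg: "is_adjoint ip f g" and K: "\<And>x. norm (f x) \<le> K * norm x"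
  shows "norm (g y) \<le> 6 * K * norm y"
proof (cases "g y = 0")
  case True
  have "0 \<le> K * norm y" using order.trans[OF norm_ge_zero K] .
  then show ?thesis using True by simp
next
  case False
  have "norm (g y) * norm (g y) = norm (ip (g y) (g y))"
    by (simp add: norm_ip_self power2_eq_square)
  also have "\<dots> = norm (ip (f (g y)) y)" using fg by (simp add: is_adjoint_def)
  also have "\<dots> \<le> 6 * (K * norm (g y) * norm y)"
    by (rule order.trans[OF norm_ip_le]) (intro mult_left_mono mult_right_mono K; simp)
  finally have "norm (g y) * norm (g y) \<le> norm (g y) * (6 * K * norm y)" by (simp add: mult_ac)
  then show ?thesis using False by simp
qed

text \<open>An adjoint already forces linearity, and the bound for \<open>f\<close> carries over to
  \<open>g\<close>, so \<open>f\<close> alone has to be estimated.\<close>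

lemma is_adjoint_bop:
  assumes fg: "is_adjoint ip f g" and K: "\<And>x. norm (f x) \<le> K * norm x"
  shows "\<exists>a a'. adjb a a' \<and> (\<star>) a = f \<and> (\<star>) a' = g"
proof -
  obtain a where a: "\<forall>x. a \<star> x = f x"
    using bop_of_bounded_linear[OF is_adjoint_bounded_linear[OF fg K]] ..
  obtain a' where a': "\<forall>x. a' \<star> x = g x"
    using bop_of_bounded_linear[OF is_adjoint_bounded_linear[OF is_adjoint_sym[OF fg] is_adjoint_bounded[OF fg K]]] ..
  have "adjb a a'" using fg a a' by (simp add: adjb_def is_adjoint_def)
  then show ?thesis using a a' by blast
qed

lemma norm_le_of_square_le:
  assumes "(norm u)\<^sup>2 \<le> c * (norm v)\<^sup>2"
  shows "norm u \<le> sqrt c * norm v"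
  using real_sqrt_le_mono[OF assms] by (simp add: real_sqrt_mult)

text \<open>Identifies the definite description in \<open>sharp_abs\<close> with the root from
  \<open>pos_sqrt\<close>. Its candidates are functions in \<open>LL ip\<close> that carry no norm
  bound, so one is derived before \<open>pos_sqrt_unique\<close> can apply.\<close>

lemma sharp_abs_bop:
  assumes s: "adjb s s'" and T: "sharp_adj ip sharp T \<circ> T = (\<star>) (s' * s)"
  obtains r where "pos r" "r * r = s' * s" "sharp_abs ip sharp T = (\<star>) r"
proof -
  obtain r where r: "pos r" "r * r = s' * s" using pos_sqrt[OF pos_mult_adjb[OF s]] by blast
  have "sharp_abs ip sharp T = (\<star>) r"
    unfolding sharp_abs_def
  proof (rule the_equality)
    obtain q where q: "pos q" "q * q = r" using pos_sqrt[OF r(1)] by blast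
    have rr: "adjb r r" and qq: "adjb q q" using r(1) q(1) pos_sa by (simp_all add: sa_def)
    have "(\<star>) r = adj ip ((\<star>) q) \<circ> (\<star>) q" by (auto simp: adj_bapp[OF qq] simp flip: q(2))
    moreover have "(\<star>) r \<circ> (\<star>) r = sharp_adj ip sharp T \<circ> T"
      unfolding T r(2)[symmetric] by auto
    ultimately show "(\<star>) r \<in> LL ip \<and> LL_positive ip ((\<star>) r) \<and>
        (\<star>) r \<circ> (\<star>) r = sharp_adj ip sharp T \<circ> T"
      using LL_bapp[OF rr] LL_bapp[OF qq] unfolding LL_positive_def by blast
  next
    fix R assume R: "R \<in> LL ip \<and> LL_positive ip R \<and> R \<circ> R = sharp_adj ip sharp T \<circ> T"
    then obtain Q Q' where Q: "is_adjoint ip Q Q'" "R = Q' \<circ> Q"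
      unfolding LL_positive_def LL_def using adj_eq by blast
    have qd: "ip (Q x) y = ip x (Q' y)" for x y using Q(1) by (simp add: is_adjoint_def)
    have qd': "ip (Q' x) y = ip x (Q y)" for x y
      using is_adjoint_sym[OF Q(1)] by (simp add: is_adjoint_def)
    have RR: "R (R x) = (s' * s) \<star> x" for x using R by (metis T comp_apply)
    \<comment> \<open>\<open>R\<close> is symmetric and its square is a bounded operator, which
      bounds \<open>R\<close>; then \<open>Q' \<circ> Q = R\<close> bounds \<open>Q\<close>.\<close>
    have "(norm (R x))\<^sup>2 \<le> 6 * norm (s' * s) * (norm x)\<^sup>2" for x
    proof -
      have "ip (R x) (R x) = ip x ((s' * s) \<star> x)" using RR[of x] by (simp add: Q(2) qd qd')
      then have "(norm (R x))\<^sup>2 \<le> 6 * (norm x * norm ((s' * s) \<star> x))"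
        using norm_ip_le by (simp flip: norm_ip_self)
      also have "\<dots> \<le> 6 * (norm x * (norm (s' * s) * norm x))"
        by (intro mult_left_mono norm_bapp) simp_all
      finally show ?thesis by (simp add: power2_eq_square mult_ac)
    qed
    note Rb = norm_le_of_square_le[OF this]
    define K where "K = sqrt (6 * norm (s' * s))"
    have "(norm (Q x))\<^sup>2 \<le> 6 * K * (norm x)\<^sup>2" for x
    proof -
      have "ip (Q x) (Q x) = ip x (R x)" by (simp add: Q(2) qd)
      then have "(norm (Q x))\<^sup>2 \<le> 6 * (norm x * norm (R x))"
        using norm_ip_le by (simp flip: norm_ip_self)
      also have "\<dots> \<le> 6 * (norm x * (K * norm x))"
        unfolding K_def by (intro mult_left_mono Rb) simp_all
      finally show ?thesis by (simp add: power2_eq_square mult_ac)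
    qed
    from is_adjoint_bop[OF Q(1) norm_le_of_square_le[OF this]]
    obtain q q' where q: "adjb q q'" "(\<star>) q = Q" "(\<star>) q' = Q'" by blast
    have R_eq: "R = (\<star>) (q' * q)" by (auto simp: Q(2) simp flip: q(2,3))
    have "(q' * q) * (q' * q) = r * r"
      by (rule bop_eqI) (use RR in \<open>simp add: R_eq r(2)\<close>)
    then have "q' * q = r" by (rule pos_sqrt_unique[OF pos_mult_adjb[OF q(1)] r(1)])
    then show "R = (\<star>) r" by (simp add: R_eq)
  qed
  then show ?thesis using r that by blast
qed

section \<open>Closed ranges and their orthogonal complements\<close>

lemma bapp_in_closure_range: "a \<star> x \<in> closure (range ((\<star>) a))"
  by (rule subsetD[OF closure_subset]) simp

lemma orth_range:
  assumes "adjb a a'"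
  shows "orth ip (closure (range ((\<star>) a))) = {y. a' \<star> y = 0}"
proof (intro equalityI subsetI CollectI)
  fix y assume "y \<in> orth ip (closure (range ((\<star>) a)))"
  then have "ip (a \<star> x) y = 0" for x
    unfolding orth_def using bapp_in_closure_range by blast
  then have "ip x (a' \<star> y) = ip x 0" for x by (simp add: adjbD[OF assms] ip.zero_right)
  then show "a' \<star> y = 0" by (rule ip_eqI_right)
next
  fix y assume "y \<in> {y. a' \<star> y = 0}"
  then have "range ((\<star>) a) \<subseteq> {x. ip x y = 0}" by (auto simp: adjbD[OF assms] ip.zero_right)
  moreover have "closed {x. ip x y = 0}"
    by (intro closed_Collect_eq continuous_on_const ip.continuous_on continuous_on_id)
  ultimately show "y \<in> orth ip (closure (range ((\<star>) a)))"
    unfolding orth_def using closure_minimal by blast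
qed

text \<open>The component of \<open>z\<close> in the complement is orthogonal to \<open>z\<close>
  and to the other component, hence to itself. For closed submodules of Hilbert modules in general
  the identity can fail.\<close>

lemma orth_orth:
  assumes "orth_complemented ip M"
  shows "orth ip (orth ip M) = M"
proof (intro equalityI subsetI)
  fix z assume z: "z \<in> orth ip (orth ip M)"
  obtain x y where xy: "x \<in> M" "y \<in> orth ip M" "z = x + y"
    using assms unfolding orth_complemented_def by blast
  have "ip y z = 0" "ip y x = 0" using z xy unfolding orth_def by (auto simp: ip_eq_0_sym[of y])
  then have "ip y y = 0" using xy(3) by (simp add: ip.add_right)
  then show "z \<in> M" using ip_definite xy by fastforce
qed (auto simp: orth_def ip_eq_0_sym)

text \<open>Orthogonality of \<open>w - w'\<close> to the range extends to the closure, which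
  contains both vectors, so \<open>w - w'\<close> is orthogonal to itself.\<close>

lemma closure_range_eqI:
  assumes w: "w \<in> closure (range ((\<star>) s))" "w' \<in> closure (range ((\<star>) s))"
    and eq: "\<And>x. ip w (s \<star> x) = ip w' (s \<star> x)"
  shows "w = w'"
proof -
  have "range ((\<star>) s) \<subseteq> {v. ip (w - w') v = 0}" by (auto simp: ip.diff_left eq)
  moreover have "closed {v. ip (w - w') v = 0}"
    by (intro closed_Collect_eq continuous_on_const ip.continuous_on continuous_on_id)
  ultimately have "ip (w - w') w = 0" "ip (w - w') w' = 0"
    using closure_minimal w by blast+
  then have "ip (w - w') (w - w') = 0" by (simp add: ip.diff_right)
  then show ?thesis using ip_definite by fastforce
qed

text \<open>The graph of \<open>r \<star> x \<mapsto> s \<star> x\<close>, extended by continuity and by zero on the complement.\<close>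

definition limit_graph :: "'e bop \<Rightarrow> 'e bop \<Rightarrow> 'e \<Rightarrow> 'e \<Rightarrow> bool"
  where "limit_graph r s z w \<longleftrightarrow> (\<exists>X m. (\<lambda>n. r \<star> X n) \<longlonglongrightarrow> m \<and>
    z - m \<in> orth ip (closure (range ((\<star>) r))) \<and> (\<lambda>n. s \<star> X n) \<longlonglongrightarrow> w)"

context
  fixes r s :: "'e bop"
  assumes ip_eq: "\<And>x y. ip (r \<star> x) (r \<star> y) = ip (s \<star> x) (s \<star> y)"
begin

text \<open>Equality of inner products makes \<open>r \<star> x \<mapsto> s \<star> x\<close>
  isometric, so it carries convergent sequences to Cauchy sequences.\<close>

lemma limit_graph_exists:
  assumes "orth_complemented ip (closure (range ((\<star>) r)))"
  shows "\<exists>w. limit_graph r s z w"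
proof -
  obtain m k where mk: "m \<in> closure (range ((\<star>) r))" "k \<in> orth ip (closure (range ((\<star>) r)))" "z = m + k"
    using assms unfolding orth_complemented_def by blast
  from mk(1) obtain f where f: "\<And>n. f n \<in> range ((\<star>) r)" "f \<longlonglongrightarrow> m"
    unfolding closure_sequential by blast
  then have "\<forall>n. \<exists>x. f n = r \<star> x" by blast
  then obtain X where X: "f = (\<lambda>n. r \<star> X n)" by metis
  have "norm (s \<star> x) = norm (r \<star> x)" for x by (simp add: norm_eq_sqrt_ip ip_eq)
  from this[of "_ - _"] have "dist (s \<star> x) (s \<star> y) = dist (r \<star> x) (r \<star> y)" for x y
    by (simp add: dist_norm bapp_linear)
  moreover have "Cauchy (\<lambda>n. r \<star> X n)" using f(2) X LIMSEQ_imp_Cauchy by blast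
  ultimately have "Cauchy (\<lambda>n. s \<star> X n)" by (simp add: Cauchy_def)
  then obtain w where "(\<lambda>n. s \<star> X n) \<longlonglongrightarrow> w" using Cauchy_convergent convergent_def by blast
  then show ?thesis
    unfolding limit_graph_def using f(2) X mk by (intro exI[of _ w] exI[of _ X] exI[of _ m]) simp
qed

text \<open>The first two facts determine \<open>w\<close> by \<open>closure_range_eqI\<close>; the
  third is the bound that \<open>is_adjoint_bop\<close> requires.\<close>

lemma limit_graphD:
  assumes "limit_graph r s z w"
  shows "w \<in> closure (range ((\<star>) s))" "ip w (s \<star> x) = ip z (r \<star> x)" "norm w \<le> 6 * norm z"
proof -
  from assms obtain X m where X: "(\<lambda>n. r \<star> X n) \<longlonglongrightarrow> m" "(\<lambda>n. s \<star> X n) \<longlonglongrightarrow> w"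
    and m: "z - m \<in> orth ip (closure (range ((\<star>) r)))"
    unfolding limit_graph_def by blast
  show "w \<in> closure (range ((\<star>) s))" unfolding closure_sequential
    using X(2) by (intro exI[of _ "\<lambda>n. s \<star> X n"]) simp
  have m_cl: "m \<in> closure (range ((\<star>) r))" unfolding closure_sequential
    using X(1) by (intro exI[of _ "\<lambda>n. r \<star> X n"]) simp
  have 0: "ip v (z - m) = 0" if "v \<in> closure (range ((\<star>) r))" for v
    using m that unfolding orth_def by blast
  have "(\<lambda>n. ip (s \<star> X n) (s \<star> x)) \<longlonglongrightarrow> ip w (s \<star> x)"
    by (intro ip.tendsto X tendsto_const)
  moreover have "(\<lambda>n. ip (r \<star> X n) (r \<star> x)) \<longlonglongrightarrow> ip m (r \<star> x)"
    by (intro ip.tendsto X tendsto_const)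
  ultimately have "ip w (s \<star> x) = ip m (r \<star> x)" by (simp add: ip_eq LIMSEQ_unique)
  moreover have "ip (z - m) (r \<star> x) = 0"
    using 0[OF bapp_in_closure_range, of x] by (simp only: ip_eq_0_sym[of "z - m"])
  ultimately show "ip w (s \<star> x) = ip z (r \<star> x)" by (simp add: ip.diff_left)
  have "norm (s \<star> x) = norm (r \<star> x)" for x by (simp add: norm_eq_sqrt_ip ip_eq)
  then have "norm w = norm m" using X[THEN tendsto_norm] by (simp add: LIMSEQ_unique)
  have "ip m m = ip m z" using 0[OF m_cl] by (simp add: ip.diff_right)
  then have "norm m * norm m \<le> 6 * (norm m * norm z)"
    using norm_ip_le[of m z] norm_ip_self[of m] by (simp add: power2_eq_square)
  then have "norm m \<le> 6 * norm z" by (cases "m = 0") (simp_all add: mult.left_commute)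
  then show "norm w \<le> 6 * norm z" using \<open>norm w = norm m\<close> by simp
qed

end

text \<open>\<open>J\<close> and \<open>J'\<close> come from the same construction with
  \<open>r\<close> and \<open>s\<close> exchanged. Adjointness is the limit of
  \<open>ip (J z) (s \<star> x) = ip z (r \<star> x)\<close>, and linearity comes with it.\<close>

lemma polar_isometry:
  assumes ip_eq: "\<And>x y. ip (r \<star> x) (r \<star> y) = ip (s \<star> x) (s \<star> y)"
    and r: "orth_complemented ip (closure (range ((\<star>) r)))"
    and s: "orth_complemented ip (closure (range ((\<star>) s)))"
  shows "\<exists>j j'. adjb j j' \<and> j * r = s \<and> j' * s = r \<and>
    (\<forall>z. j' \<star> j \<star> z \<in> closure (range ((\<star>) r))) \<and>
    (\<forall>z\<in>closure (range ((\<star>) r)). j' \<star> j \<star> z = z)"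
proof -
  obtain J where J: "\<And>z. limit_graph r s z (J z)"
    using limit_graph_exists[OF ip_eq r] by metis
  obtain J' where J': "\<And>z. limit_graph s r z (J' z)"
    using limit_graph_exists[OF ip_eq[symmetric] s] by metis
  note JD = limit_graphD[OF ip_eq J] and JD' = limit_graphD[OF ip_eq[symmetric] J']
  have "is_adjoint ip J J'"
    unfolding is_adjoint_def
  proof (intro allI)
    fix z w
    obtain X n where X: "(\<lambda>k. s \<star> X k) \<longlonglongrightarrow> n" "(\<lambda>k. r \<star> X k) \<longlonglongrightarrow> J' w"
      and n: "w - n \<in> orth ip (closure (range ((\<star>) s)))"
      using J'[of w] unfolding limit_graph_def by blast
    have "(\<lambda>k. ip (J z) (s \<star> X k)) \<longlonglongrightarrow> ip (J z) n" by (intro ip.tendsto X tendsto_const)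
    moreover have "(\<lambda>k. ip z (r \<star> X k)) \<longlonglongrightarrow> ip z (J' w)" by (intro ip.tendsto X tendsto_const)
    ultimately have "ip (J z) n = ip z (J' w)" by (simp add: JD LIMSEQ_unique)
    moreover have "ip (J z) (w - n) = 0" using JD(1) n unfolding orth_def by blast
    ultimately show "ip (J z) w = ip z (J' w)" by (simp add: ip.diff_right)
  qed
  from is_adjoint_bop[OF this JD(3)]
  obtain j j' where j: "adjb j j'" "(\<star>) j = J" "(\<star>) j' = J'" by blast
  have "j * r = s"
    by (rule bop_eqI, rule closure_range_eqI[of _ s]) (simp_all add: j JD ip_eq bapp_in_closure_range)
  moreover have "j' * s = r"
    by (rule bop_eqI, rule closure_range_eqI[of _ r]) (simp_all add: j JD' ip_eq bapp_in_closure_range)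
  moreover have "j' \<star> j \<star> z = z" if "z \<in> closure (range ((\<star>) r))" for z
    by (rule closure_range_eqI[of _ r]) (simp_all add: j JD JD' that)
  ultimately show ?thesis using j JD'(1) by (intro exI[of _ j] exI[of _ j']) simp
qed

end

section \<open>Conjugate-linear operators\<close>

text \<open>Conjugation fixes real scalars, so conjugate-linear maps also live in the real algebra
  \<open>bop\<close>.\<close>

lemma bounded_conj_linear_bop:
  assumes "bounded_conj_linear f"
  shows "\<exists>a. \<forall>x. a \<star> x = f x"
proof -
  have f: "f (c *\<^sub>C x + y) = cnj c *\<^sub>C f x + f y" for c x y
    using assms by (simp add: bounded_conj_linear_def)
  have add: "f (x + y) = f x + f y" for x y using f[of 1 x y] by (simp add: scaleC_one)
  have "f 0 = 0" using add[of 0 0] by simp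
  then have scale: "f (r *\<^sub>R x) = r *\<^sub>R f x" for r x
    using f[of "complex_of_real r" x 0] by (simp add: scaleC_of_real)
  obtain K where "\<And>x. norm (f x) \<le> norm x * K"
    using assms by (auto simp: bounded_conj_linear_def mult.commute)
  with add scale have "bounded_linear f" by (rule bounded_linear_intro)
  then show ?thesis by (rule bop_of_bounded_linear)
qed

locale sharp_hilbert_module = hilbert_module act ip + star_conj_automorphism sharp
  for act :: "'e::complex_banach \<Rightarrow> 'a::cstar_algebra \<Rightarrow> 'e"
    and ip :: "'e \<Rightarrow> 'e \<Rightarrow> 'a" and sharp :: "'a \<Rightarrow> 'a"
begin

lemma sharp_0: "sharp 0 = 0"
  using sharp_conj_linear[of 1 0 0] by (simp add: scaleC_one)

lemma sharp_adj_eq: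
  assumes "is_sharp_adjoint ip sharp f g"
  shows "sharp_adj ip sharp f = g"
  unfolding sharp_adj_def
proof (rule the_equality)
  fix h assume "is_sharp_adjoint ip sharp f h"
  then have "sharp (ip x (h y)) = sharp (ip x (g y))" for x y
    using assms unfolding is_sharp_adjoint_def by metis
  then have "ip x (h y) = ip x (g y)" for x y by (metis sharp_sharp)
  then show "h = g" using ip_eqI_right by blast
qed (rule assms)

lemma bounded_conj_linear_conj_comp:
  assumes C: "bounded_conj_linear ((\<star>) c)" and j: "adjb j j'"
  shows "bounded_conj_linear ((\<star>) (c * j))" "bounded_conj_linear ((\<star>) (j * c))"
proof -
  have c: "c \<star> (l *\<^sub>C x) = cnj l *\<^sub>C (c \<star> x)" for l x
  proof -
    have "c \<star> (l *\<^sub>C x + 0) = cnj l *\<^sub>C (c \<star> x) + c \<star> 0"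
      using C unfolding bounded_conj_linear_def by blast
    then show ?thesis by (simp add: bapp_linear)
  qed
  show "bounded_conj_linear ((\<star>) (c * j))" "bounded_conj_linear ((\<star>) (j * c))"
    unfolding bounded_conj_linear_def using norm_bapp[of "c * j"] norm_bapp[of "j * c"]
    by (auto simp: bapp_linear c adjb_scaleC[OF j] simp del: bapp_simps(6)) (auto simp: bapp_linear c adjb_scaleC[OF j])
qed

end

section \<open>Polar decomposition of a semiregular conjugate-linear operator\<close>

theorem theorem5p6:
  fixes act :: "'e::complex_banach \<Rightarrow> 'a::cstar_algebra \<Rightarrow> 'e"
    and ip :: "'e \<Rightarrow> 'e \<Rightarrow> 'a"
    and sharp :: "'a \<Rightarrow> 'a"
    and C T :: "'e \<Rightarrow> 'e"
  assumes "star_conj_automorphism sharp"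
    and "hilbert_module act ip"
    and "sharp_conjugation ip sharp C"
    and "T \<in> LLc ip sharp"
    and "semiregular_c ip sharp T"
  shows "\<exists>V P. V \<in> LLc ip sharp \<and> conj_partial_isometry ip sharp V \<and>
    initial_submodule ip V = closure (range (sharp_adj ip sharp T)) \<and>
    T = V \<circ> sharp_abs ip sharp T \<and>
    sharp_adj ip sharp V \<circ> T = sharp_abs ip sharp T \<and>
    P = sharp_adj ip sharp V \<circ> V \<and>
    is_projection_onto ip P (initial_submodule ip V) \<and>
    (\<exists>J. J \<in> LL ip \<and> partial_isometry ip J \<and> adj ip J \<circ> J = P \<and>
      T = C \<circ> J \<circ> sharp_abs ip sharp T \<and>
      (V = C \<circ> sharp_adj ip sharp V \<circ> C \<longrightarrow> J \<circ> J = P \<and> J \<circ> P = J \<and> P \<circ> J = J))"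
proof -
  interpret sharp_hilbert_module act ip sharp
    using assms(1,2) by (rule sharp_hilbert_module.intro[rotated])
  have Cb: "bounded_conj_linear C" and C2: "\<And>x. C (C x) = x"
    and ipC: "\<And>x y. ip (C x) (C y) = sharp (ip x y)"
    using assms(3) by (auto simp: sharp_conjugation_def fun_eq_iff)
  obtain T' where T': "is_sharp_adjoint ip sharp T T'"
    using assms(4) by (auto simp: LLc_def)
  have adjT: "sharp_adj ip sharp T = T'" by (rule sharp_adj_eq[OF T'])
  have ipT: "ip (T x) y = sharp (ip x (T' y))" for x y
    using T' by (simp add: is_sharp_adjoint_def)
  have ipC': "ip (C x) y = sharp (ip x (C y))" for x y
    using ipC[of x "C y"] by (simp add: C2)
  have "bounded_conj_linear T" "bounded_conj_linear T'"
    using assms(4) T' by (auto simp: LLc_def is_sharp_adjoint_def)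
  then obtain c t t' where c: "\<And>x. c \<star> x = C x" and t: "\<And>x. t \<star> x = T x" and t': "\<And>x. t' \<star> x = T' x"
    using Cb bounded_conj_linear_bop by metis
  define s where "s = c * t"
  define s' where "s' = t' * c"
  have s: "s \<star> x = C (T x)" and s': "s' \<star> x = T' (C x)" for x
    by (simp_all add: s_def s'_def c t t')
  \<comment> \<open>Moving \<open>C\<close> and then \<open>T\<close> across the inner product
    applies \<open>sharp\<close> twice, which cancels.\<close>
  have ss: "adjb s s'"
    by (rule adjbI) (simp add: s s' ipC' ipT sharp_sharp)
  have "sharp_adj ip sharp T \<circ> T = (\<star>) (s' * s)"
    by (auto simp: adjT s s' C2)
  from sharp_abs_bop[OF ss this] obtain r
    where r: "pos r" "r * r = s' * s" and R: "sharp_abs ip sharp T = (\<star>) r" .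
  have rr: "adjb r r" using pos_sa[OF r(1)] by (simp add: sa_def)
  have ip_eq: "ip (r \<star> x) (r \<star> y) = ip (s \<star> x) (s \<star> y)" for x y
  proof -
    have "ip (r \<star> x) (r \<star> y) = ip x ((r * r) \<star> y)" by (simp add: adjbD[OF rr])
    also have "\<dots> = ip (s \<star> x) (s \<star> y)" by (simp add: r(2) adjbD[OF ss])
    finally show ?thesis .
  qed
  have r0: "r \<star> x = 0 \<longleftrightarrow> s \<star> x = 0" for x
    using norm_eq_sqrt_ip[of "r \<star> x"] norm_eq_sqrt_ip[of "s \<star> x"] by (metis ip_eq norm_eq_zero)

  define M where "M = closure (range T')"
  have M: "orth_complemented ip M"
    using assms(5) by (simp add: semiregular_c_def adjT M_def)
  have "range T' = range ((\<star>) s')" unfolding s' by (metis C2 surj_def image_image surjI)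
  then have M_s': "M = closure (range ((\<star>) s'))" by (simp add: M_def)
  \<comment> \<open>For one inclusion, \<open>r\<close> and \<open>s\<close> have the same kernel,
    so both sides have the same orthogonal complement, and \<open>M\<close> is its own double
    complement. For the other, \<open>s' \<star> y\<close> is a limit of vectors
    \<open>s' \<star> s \<star> x = r \<star> r \<star> x\<close>.\<close>
  have M_r: "closure (range ((\<star>) r)) = M"
  proof
    have "orth ip (closure (range ((\<star>) r))) = orth ip M"
      unfolding M_s' orth_range[OF rr] orth_range[OF adjb_sym[OF ss]] by (simp add: r0)
    moreover have "A \<subseteq> orth ip (orth ip A)" for A
      unfolding orth_def using ip_eq_0_sym by blast
    ultimately have "closure (range ((\<star>) r)) \<subseteq> orth ip (orth ip M)" by metis
    then show "closure (range ((\<star>) r)) \<subseteq> M" using orth_orth[OF M] by simp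
    have "s' \<star> s \<star> x = r \<star> r \<star> x" for x by (metis bapp_simps(6) r(2))
    then have "closure (range (\<lambda>x. s' \<star> s \<star> x)) \<subseteq> closure (range ((\<star>) r))"
      by (intro closure_mono) auto
    then show "M \<subseteq> closure (range ((\<star>) r))"
      unfolding M_s' using adjb_in_closure_range[OF ss] by (intro closure_minimal) auto
  qed
  \<comment> \<open>\<open>C\<close> carries a splitting along the closed range of \<open>T\<close>
    to one along the closed range of \<open>s\<close>.\<close>
  have N: "orth_complemented ip (closure (range ((\<star>) s)))"
    unfolding orth_complemented_def
  proof
    fix z
    obtain x y where x: "x \<in> closure (range T)" and y: "y \<in> orth ip (closure (range T))" and "C z = x + y"
      using assms(5) unfolding semiregular_c_def orth_complemented_def by blast
    then have "z = C x + C y" by (metis C2 c bapp_linear(2))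
    moreover have "C ` closure (range T) \<subseteq> closure (range ((\<star>) s))"
    proof (rule image_closure_subset)
      show "continuous_on (closure (range T)) C"
        using linear_continuous_on[OF bounded_linear_bapp[of c]] by (simp add: c)
      show "C ` range T \<subseteq> closure (range ((\<star>) s))"
        using bapp_in_closure_range[of s] by (auto simp: s)
    qed simp
    moreover have "C y \<in> orth ip (closure (range ((\<star>) s)))"
    proof -
      have "ip (T x) y = 0" for x using y closure_subset[of "range T"] unfolding orth_def by blast
      then have "ip x (T' y) = ip x 0" for x
        using ipT sharp_sharp sharp_0 by (metis ip.zero_right)
      then have "T' y = 0" by (rule ip_eqI_right)
      then show ?thesis by (simp add: orth_range[OF ss] s' C2)
    qed
    ultimately show "\<exists>x\<in>closure (range ((\<star>) s)). \<exists>y\<in>orth ip (closure (range ((\<star>) s))). z = x + y"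
      using x by blast
  qed
  have "orth_complemented ip (closure (range ((\<star>) r)))" using M by (simp add: M_r)
  from polar_isometry[OF ip_eq this N] obtain j j' where j: "adjb j j'" and jr: "j * r = s" and js: "j' * s = r"
    and P_in: "\<And>z. j' \<star> j \<star> z \<in> M" and P_id: "\<And>z. z \<in> M \<Longrightarrow> j' \<star> j \<star> z = z"
    unfolding M_r by blast
  note ipj = adjbD[OF j] and ipj' = adjbD[OF adjb_sym[OF j]]
  have j0: "j \<star> x = 0 \<longleftrightarrow> x \<in> orth ip M" for x
  proof
    assume "j \<star> x = 0"
    have "ip m x = 0" if "m \<in> M" for m
    proof -
      have "ip m x = ip (j' \<star> j \<star> m) x" by (simp add: P_id that)
      also have "\<dots> = 0" by (simp add: ipj' \<open>j \<star> x = 0\<close> ip.zero_right)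
      finally show ?thesis .
    qed
    then show "x \<in> orth ip M" by (simp add: orth_def)
  next
    assume "x \<in> orth ip M"
    then have "ip (j' \<star> j \<star> x) x = 0" using P_in by (simp add: orth_def)
    then show "j \<star> x = 0" using ip_definite by (simp add: ipj')
  qed
  \<comment> \<open>The difference \<open>x - j' \<star> j \<star> x\<close> is annihilated by
    \<open>j' * j\<close>, hence by \<open>j\<close>.\<close>
  have jjj: "j \<star> j' \<star> j \<star> x = j \<star> x" for x
  proof -
    have "j' \<star> j \<star> (x - j' \<star> j \<star> x) = 0" by (simp add: bapp_linear P_id P_in)
    then have "j \<star> (x - j' \<star> j \<star> x) = 0"
      by (intro ip_definite) (simp only: ipj ip.zero_right)
    then show ?thesis by (simp add: bapp_linear)
  qed

  define V where "V = (\<star>) (c * j)"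
  define V' where "V' = (\<star>) (j' * c)"
  define P where "P = (\<star>) (j' * j)"
  have V: "V x = C (j \<star> x)" and V': "V' x = j' \<star> C x" and P: "P x = j' \<star> j \<star> x" for x
    by (simp_all add: V_def V'_def P_def c)
  have "(\<star>) c = C" by (simp add: c fun_eq_iff)
  then have bV: "bounded_conj_linear V" "bounded_conj_linear V'"
    unfolding V_def V'_def using bounded_conj_linear_conj_comp Cb j adjb_sym[OF j] by blast+
  then have sV: "is_sharp_adjoint ip sharp V V'"
    by (simp add: is_sharp_adjoint_def V V' ipC' ipj)
  have adjV: "sharp_adj ip sharp V = V'" by (rule sharp_adj_eq[OF sV])
  have V_LLc: "V \<in> LLc ip sharp" using bV sV by (auto simp: LLc_def)
  have "V x = 0 \<longleftrightarrow> x \<in> orth ip M" for x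
    unfolding V j0[symmetric] by (metis C2 c bapp_linear(1))
  then have init: "initial_submodule ip V = M"
    by (simp add: initial_submodule_def orth_orth[OF M])
  have "conj_partial_isometry ip sharp V"
    unfolding conj_partial_isometry_def init using V_LLc by (simp add: V ipC ipj P_id)
  moreover have TV: "T = C \<circ> (\<star>) j \<circ> sharp_abs ip sharp T"
  proof
    fix x
    have "j \<star> r \<star> x = C (T x)" by (metis bapp_simps(6) jr s)
    then show "T x = (C \<circ> (\<star>) j \<circ> sharp_abs ip sharp T) x" by (simp add: R C2)
  qed
  moreover have "T = V \<circ> sharp_abs ip sharp T" by (subst TV) (auto simp: V)
  moreover have "V' \<circ> T = sharp_abs ip sharp T"
    unfolding R by (auto simp: V' simp flip: s js)
  moreover have PV: "P = V' \<circ> V" by (auto simp: P V V' C2)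
  moreover have "is_projection_onto ip P M"
  proof -
    have "adjb (j' * j) (j' * j)" by (intro adjb_intros adjb_sym[OF j] j)
    then have "P \<in> LL ip" "adj ip P = P" unfolding P_def by (rule LL_bapp adj_bapp)+
    moreover have "P \<circ> P = P" by (auto simp: P P_id P_in)
    moreover have "range P = M"
    proof
      show "M \<subseteq> range P" using P_id unfolding P by (metis rangeI subsetI)
    qed (auto simp: P P_in)
    ultimately show ?thesis by (simp add: is_projection_onto_def)
  qed
  moreover have "partial_isometry ip ((\<star>) j)" "(\<star>) j \<in> LL ip"
    unfolding partial_isometry_def using LL_bapp[OF j] by (auto simp: adj_bapp[OF j] jjj)
  moreover have "adj ip ((\<star>) j) \<circ> (\<star>) j = P" by (auto simp: adj_bapp[OF j] P)
  moreover have "(\<star>) j \<circ> (\<star>) j = P \<and> (\<star>) j \<circ> P = (\<star>) j \<and> P \<circ> (\<star>) j = (\<star>) j"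
    if "V = C \<circ> V' \<circ> C"
  proof -
    \<comment> \<open>As \<open>V = C \<circ> (\<star>) j\<close> and
      \<open>V' = (\<star>) j' \<circ> C\<close>, the symmetry of \<open>V\<close> says that
      \<open>j\<close> is self-adjoint, so \<open>j * j\<close> is \<open>j' * j\<close>.\<close>
    have "C (j \<star> x) = C (j' \<star> x)" for x using fun_cong[OF that, of x] by (simp add: V V' C2)
    then have "j' \<star> x = j \<star> x" for x by (metis C2)
    then show ?thesis using jjj by (auto simp: P)
  qed
  ultimately show ?thesis
    using V_LLc unfolding adjT adjV M_def[symmetric] init[symmetric] by (intro exI[of _ V] exI[of _ P]) (auto simp: init adjV)
qed

end
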